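(* Let $\Phi,\Psi\in\overline{\varPhi}_Y$ and $\rho:(0,\infty)\to(0,\infty)$. (i) If there exists a positive constant $A$ such that, for all $r\in(0,\infty)$, $$\Big(\sup_{0<t\le r}\rho(t)\Big)\Phi^{-1}(1/r^n)\le A\,\Psi^{-1}(1/r^n),\qquad( * )$$ then, for any positive constant $C_0$, there exists a positive constant $C_1$ such that, for all $f\in L^\Phi(\mathbb{R}^n)$ with $f\not\equiv0$, $$\Psi\left(\frac{M_\rho f(x)}{C_1\|f\|_{L^\Phi}}\right)\le\Phi\left(\frac{Mf(x)}{C_0\|f\|_{L^\Phi}}\right),\quad x\in\mathbb{R}^n.$$ Consequently, $M_\rho$ is bounded from $L^\Phi(\mathbb{R}^n)$ to $\mathrm{w}L^\Psi(\mathbb{R}^n)$. Moreover, if $\Phi\in\overline\nabla_2$, then, for all $f\in\mathrm{w}L^\Phi(\mathbb{R}^n)$ with $f\not\equiv0$, $$\Psi\left(\frac{M_\rho f(x)}{C_1\|f\|_{\mathrm{w}L^\Phi}}\right)\le\Phi\left(\frac{Mf(x)}{C_0\|f\|_{\mathrm{w}L^\Phi}}\right),\quad x\in\mathbb{R}^n.$$ Consequently, if $\Phi\in\overline\nabla_2$, then $M_\rho$ is bounded from $L^\Phi(\mathbb{R}^n)$ to $L^\Psi(\mathbb{R}^n)$ and from $\mathrm{w}L^\Phi(\mathbb{R}^n)$ to $\mathrm{w}L^\Psi(\mathbb{R}^n)$. (ii) If $M_\rho$ is bounded from $L^\Phi(\mathbb{R}^n)$ to $\mathrm{w}L^\Psi(\mathbb{R}^n)$,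 then $( * )$ holds for some $A\in(0,\infty)$ and for all $r\in(0,\infty)$. (iii) In part (ii), the boundedness from $L^\Phi(\mathbb{R}^n)$ to $\mathrm{w}L^\Psi(\mathbb{R}^n)$ can be replaced by the boundedness from $L^\Phi(\mathbb{R}^n)$ to $L^{(1,\psi)}(\mathbb{R}^n)$ with $\psi(r)=\Psi^{-1}(1/r^n)$; that is, if $M_\rho$ is bounded from $L^\Phi(\mathbb{R}^n)$ to $L^{(1,\psi)}(\mathbb{R}^n)$, then $( * )$ holds for some $A\in(0,\infty)$ and for all $r\in(0,\infty)$.
   Context: $|G|$ is the Lebesgue measure of $G\subset\mathbb{R}^n$; $B(a,r)$ is the open ball with center $a$ and radius $r$; $m(f,t)=|\{x\in\mathbb{R}^n:|f(x)|>t\}|$. The generalized fractional maximal operator is $M_\rho f(x)=\sup_{B(a,r)\ni x}\rho(r)\frac1{|B(a,r)|}\int_{B(a,r)}|f(y)|\,dy$, supremum over all balls $B(a,r)$ containing $x$; $M$ is the Hardy-Littlewood maximal operator, i.e. $M_\rho$ with $\rho\equiv1$. No conditions on $\rho$ other than positivity are imposed. An operator $T$ is bounded from $X$ to $Y$ if there is a constant $C>0$ with $\|Tf\|_Y\le C\|f\|_X$ for all $f\in X$. "Increasing" means nondecreasing. For an increasing $\Phi:[0,\infty]\to[0,\infty]$ let $a(\Phi)=\sup\{t\ge0:\Phi(t)=0\}$ and $b(\Phi)=\inf\{t\ge0:\Phi(t)=\infty\}$, with $\sup\emptyset=0$, $\inf\emptyset=\infty$. $\overline{\varPhi}$ is the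 set of all increasing $\Phi:[0,\infty]\to[0,\infty]$ such that: $0\le a(\Phi)<\infty$ and $0<b(\Phi)\le\infty$; $\lim_{t\to+0}\Phi(t)=\Phi(0)=0$; $\Phi$ is left continuous on $[0,b(\Phi))$; if $b(\Phi)=\infty$ then $\lim_{t\to\infty}\Phi(t)=\Phi(\infty)=\infty$; if $b(\Phi)<\infty$ then $\lim_{t\to b(\Phi)-0}\Phi(t)=\Phi(b(\Phi))$ $(\le\infty)$. For $\Phi\in\overline{\varPhi}$ the generalized inverse is $\Phi^{-1}(u)=\inf\{t\ge0:\Phi(t)>u\}$ for $u\in[0,\infty)$ and $\Phi^{-1}(\infty)=\infty$. $\Phi\in\overline{\varPhi}$ is a Young function if it is convex on $[0,b(\Phi))$; $\varPhi_Y$ is the set of Young functions. $\Phi\approx\Psi$ means there is $C>0$ with $\Phi(C^{-1}t)\le\Psi(t)\le\Phi(Ct)$ for all $t\in[0,\infty]$. $\overline{\varPhi}_Y$ is the set of all $\Phi\in\overline{\varPhi}$ such that $\Phi\approx\Psi$ for some $\Psi\in\varPhi_Y$. $\overline\nabla_2$ is the set of all $\Phi\in\overline{\varPhi}$ for which there is $k>1$ with $\Phi(t)\le\frac1{2k}\Phi(kt)$ for all $t>0$. For $\Phi\in\overline{\varPhi}_Y$, the Orlicz space $L^\Phi(\mathbb{R}^n)$ and weak Orlicz space $\mathrm{w}L^\Phi(\mathbb{R}^n)$ are the sets of measurable $f$ on $\mathbb{R}^n$ for which, respectively, $$\|f\|_{L^\Phi}=\inf\Big\{\lambda>0:\int_{\mathbb{R}^n}\Phi\Big(\frac{|f(x)|}\lambda\Big)dx\le1\Big\},\quad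 \|f\|_{\mathrm{w}L^\Phi}=\inf\Big\{\lambda>0:\sup_{t\in(0,\infty)}\Phi(t)\,m(f/\lambda,t)\le1\Big\}$$ is finite (with $0\cdot\infty=0$). For $\psi:(0,\infty)\to(0,\infty)$, $L^{(1,\psi)}(\mathbb{R}^n)$ is the set of measurable $f$ with $\|f\|_{L^{(1,\psi)}}=\sup_{B=B(a,r)}\frac1{\psi(r)|B|}\int_B|f(x)|\,dx<\infty$, supremum over all balls. *)

theory Defs
  imports "HOL-Analysis.Analysis"
begin

section \<open>Generalized Young functions\<close>

text \<open>The interval \<open>[0,\<infinity>]\<close> is the type \<^typ>\<open>ennreal\<close>; limits at \<open>\<infinity>\<close> are limits along
  \<open>at_left \<infinity>\<close>.\<close>

definition a_of :: "(ennreal \<Rightarrow> ennreal) \<Rightarrow> ennreal" where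
  "a_of \<Phi> = Sup {t. \<Phi> t = 0}"

definition b_of :: "(ennreal \<Rightarrow> ennreal) \<Rightarrow> ennreal" where
  "b_of \<Phi> = Inf {t. \<Phi> t = \<infinity>}"

definition Phi_bar :: "(ennreal \<Rightarrow> ennreal) set" where
  "Phi_bar = {\<Phi>. mono \<Phi> \<and>
     0 \<le> a_of \<Phi> \<and> a_of \<Phi> < \<infinity> \<and> 0 < b_of \<Phi> \<and> b_of \<Phi> \<le> \<infinity> \<and>
     (\<Phi> \<longlongrightarrow> \<Phi> 0) (at_right 0) \<and> \<Phi> 0 = 0 \<and>
     (\<forall>t < b_of \<Phi>. (\<Phi> \<longlongrightarrow> \<Phi> t) (at_left t)) \<and>
     (b_of \<Phi> = \<infinity> \<longrightarrow> (\<Phi> \<longlongrightarrow> \<Phi> \<infinity>) (at_left \<infinity>) \<and> \<Phi> \<infinity> = \<infinity>) \<and>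
     (b_of \<Phi> < \<infinity> \<longrightarrow> (\<Phi> \<longlongrightarrow> \<Phi> (b_of \<Phi>)) (at_left (b_of \<Phi>)))}"

definition gen_inv :: "(ennreal \<Rightarrow> ennreal) \<Rightarrow> ennreal \<Rightarrow> ennreal" where
  "gen_inv \<Phi> u = (if u = \<infinity> then \<infinity> else Inf {t. \<Phi> t > u})"

text \<open>By definition of \<^const>\<open>b_of\<close>, \<open>\<Phi>\<close> is finite on \<open>[0, b(\<Phi>))\<close>, so no information is
  lost by \<^const>\<open>enn2real\<close> below.\<close>

definition Young_functions :: "(ennreal \<Rightarrow> ennreal) set" where
  "Young_functions = {\<Phi> \<in> Phi_bar.
     convex_on {t::real. 0 \<le> t \<and> ennreal t < b_of \<Phi>} (\<lambda>t. enn2real (\<Phi> (ennreal t)))}"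

definition Phi_equiv :: "(ennreal \<Rightarrow> ennreal) \<Rightarrow> (ennreal \<Rightarrow> ennreal) \<Rightarrow> bool" where
  "Phi_equiv \<Phi> \<Psi> \<longleftrightarrow> (\<exists>C::real. C > 0 \<and>
     (\<forall>t. \<Phi> (ennreal (1 / C) * t) \<le> \<Psi> t \<and> \<Psi> t \<le> \<Phi> (ennreal C * t)))"

definition Phi_bar_Y :: "(ennreal \<Rightarrow> ennreal) set" where
  "Phi_bar_Y = {\<Phi> \<in> Phi_bar. \<exists>\<Psi> \<in> Young_functions. Phi_equiv \<Phi> \<Psi>}"

definition nabla2_bar :: "(ennreal \<Rightarrow> ennreal) set" where
  "nabla2_bar = {\<Phi> \<in> Phi_bar. \<exists>k::real. k > 1 \<and>
     (\<forall>t > 0. \<Phi> t \<le> ennreal (1 / (2 * k)) * \<Phi> (ennreal k * t))}"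


section \<open>Function spaces\<close>

text \<open>Functions are extended-real-valued, because maximal functions may take the value \<open>\<infinity>\<close>
  at some points. Norms are defined for all functions, with \<open>inf \<emptyset> = \<infinity>\<close>; the
  space belonging to a norm consists of the measurable functions of finite norm.\<close>

type_synonym 'n fn = "real ^ 'n \<Rightarrow> ereal"

definition distr_fun :: "'n::finite fn \<Rightarrow> real \<Rightarrow> ennreal" where
  "distr_fun f t = emeasure lebesgue {x. \<bar>f x\<bar> > ereal t}"

definition orlicz_norm :: "(ennreal \<Rightarrow> ennreal) \<Rightarrow> 'n::finite fn \<Rightarrow> ennreal" where
  "orlicz_norm \<Phi> f =
     (INF l\<in>{l::real. l > 0 \<and> (\<integral>\<^sup>+x. \<Phi> (e2ennreal (\<bar>f x\<bar> / ereal l)) \<partial>lebesgue) \<le> 1}. ennreal l)"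

definition weak_orlicz_norm :: "(ennreal \<Rightarrow> ennreal) \<Rightarrow> 'n::finite fn \<Rightarrow> ennreal" where
  "weak_orlicz_norm \<Phi> f =
     (INF l\<in>{l::real. l > 0 \<and>
        (SUP t\<in>{0<..}. \<Phi> (ennreal t) * distr_fun (\<lambda>x. f x / ereal l) t) \<le> 1}. ennreal l)"

definition L1psi_norm :: "(real \<Rightarrow> ennreal) \<Rightarrow> 'n::finite fn \<Rightarrow> ennreal" where
  "L1psi_norm \<psi> f =
     (SUP (a, r)\<in>{(a, r). r > 0}.
        (\<integral>\<^sup>+y\<in>ball a r. e2ennreal \<bar>f y\<bar> \<partial>lebesgue) / (\<psi> r * emeasure lebesgue (ball a r)))"

definition fn_space :: "('n::finite fn \<Rightarrow> ennreal) \<Rightarrow> 'n fn set" where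
  "fn_space N = {f \<in> borel_measurable lebesgue. N f < \<infinity>}"

abbreviation orlicz_space :: "(ennreal \<Rightarrow> ennreal) \<Rightarrow> 'n::finite fn set" where
  "orlicz_space \<Phi> \<equiv> fn_space (orlicz_norm \<Phi>)"

abbreviation weak_orlicz_space :: "(ennreal \<Rightarrow> ennreal) \<Rightarrow> 'n::finite fn set" where
  "weak_orlicz_space \<Phi> \<equiv> fn_space (weak_orlicz_norm \<Phi>)"

definition bounded_operator ::
  "('n::finite fn \<Rightarrow> 'n fn) \<Rightarrow> ('n fn \<Rightarrow> ennreal) \<Rightarrow> ('n fn \<Rightarrow> ennreal) \<Rightarrow> bool" where
  "bounded_operator T N N' \<longleftrightarrow> (\<exists>C::real. C > 0 \<and>
     (\<forall>f \<in> fn_space N. T f \<in> fn_space N' \<and> N' (T f) \<le> ennreal C * N f))"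


section \<open>Maximal operators\<close>

definition frac_maximal :: "(real \<Rightarrow> real) \<Rightarrow> 'n::finite fn \<Rightarrow> real ^ 'n \<Rightarrow> ennreal" where
  "frac_maximal \<rho> f x =
     (SUP (a, r)\<in>{(a, r). r > 0 \<and> x \<in> ball a r}.
        ennreal (\<rho> r) *
        ((\<integral>\<^sup>+y\<in>ball a r. e2ennreal \<bar>f y\<bar> \<partial>lebesgue) / emeasure lebesgue (ball a r)))"

abbreviation HL_maximal :: "'n::finite fn \<Rightarrow> real ^ 'n \<Rightarrow> ennreal" where
  "HL_maximal \<equiv> frac_maximal (\<lambda>_. 1)"

definition frac_maximal_op :: "(real \<Rightarrow> real) \<Rightarrow> 'n::finite fn \<Rightarrow> 'n fn" where
  "frac_maximal_op \<rho> f = (\<lambda>x. enn2ereal (frac_maximal \<rho> f x))"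

definition sup_rho_condition ::
  "nat \<Rightarrow> (real \<Rightarrow> real) \<Rightarrow> (ennreal \<Rightarrow> ennreal) \<Rightarrow> (ennreal \<Rightarrow> ennreal) \<Rightarrow> real \<Rightarrow> bool" where
  "sup_rho_condition n \<rho> \<Phi> \<Psi> A \<longleftrightarrow> (\<forall>r > 0.
     (SUP t\<in>{0<..r}. ennreal (\<rho> t)) * gen_inv \<Phi> (ennreal (1 / r ^ n))
       \<le> ennreal A * gen_inv \<Psi> (ennreal (1 / r ^ n)))"

end

theory Submission imports Defs begin

text \<open>
  Up to constants, a Young function enters only through the scaling property
  \<open>\<theta> \<Phi>(t) \<le> \<Phi>(c \<theta> t)\<close> for \<open>\<theta> \<ge> 1\<close>, which replaces Jensen's inequality: if \<open>0 < v \<le> \<Phi>(T)\<close>, then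
  \<open>g \<le> c T + (c T / v) \<Phi>(g)\<close>. Under \<open>\<nabla>\<^sub>2\<close> a geometric sum of level sets gives the same kind of
  splitting \<open>g \<le> \<kappa> T + G\<close>, \<open>\<integral>G \<le> \<kappa> T / v\<close>, for \<open>g\<close> in the weak unit ball. Such splittings bound the
  average of \<open>\<bar>f\<bar>\<close> over a ball of radius \<open>r\<close> by a multiple of \<open>\<parallel>f\<parallel> \<Phi>\<inverse>(1 / r\<^sup>n)\<close>, and with Vitali's
  covering lemma they bound the level sets of \<open>M f\<close>. The pointwise inequality is Hedberg's argument:
  balls of radius at most \<open>R\<close> are controlled by \<open>M f(x)\<close> and larger ones by the norm, where
  \<open>1 / R\<^sup>n\<close> is slightly above \<open>\<Phi>(M f(x) / (C\<^sub>0 \<parallel>f\<parallel>))\<close>. For the converse, \<open>M\<^sub>\<rho>\<close> of the indicator of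
  \<open>B(0, R)\<close> is at least \<open>sup {\<rho>(t) | 0 < t \<le> R}\<close> on \<open>B(0, R)\<close>.
\<close>

section \<open>Generalized inverses and scaling\<close>

text \<open>The obstacle is that \<Phi> need be neither convex, strictly increasing nor finite: it
  may vanish near 0, jump, or become infinite at a finite point. So \<Phi> (\<Phi>^-1 u) can be
  smaller than u, and \<Phi> T can be 0 or infinite where one would like to divide by it. Two
  devices deal with this. The inverse is handled through the equivalence
  \<open>gen_inv_less_iff\<close>, and values of \<Phi> are compared through an auxiliary real
  number v or u, positive and finite, inserted by density.

  The function \<rho> has no regularity either, which is why a supremum of \<rho> appears in the
  condition: one use of it at R serves all balls of radius at most R.

  The strong bound for M f under \<open>nabla2_bar\<close> is a discrete form of Marcinkiewicz
  interpolation over the levels k^j with j an integer. The factor 2 in the nabla-2 inequality turns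
  the sum over levels into a geometric series.\<close>

lemma Phi_bar_mono: "\<Phi> \<in> Phi_bar \<Longrightarrow> mono \<Phi>"
  and Phi_bar_zero: "\<Phi> \<in> Phi_bar \<Longrightarrow> \<Phi> 0 = 0"
  by (auto simp: Phi_bar_def)

lemma Phi_bar_le: "\<Phi> \<in> Phi_bar \<Longrightarrow> s \<le> t \<Longrightarrow> \<Phi> s \<le> \<Phi> t"
  by (meson Phi_bar_mono monoD)

lemma Phi_bar_above_b:
  assumes "\<Phi> \<in> Phi_bar" "b_of \<Phi> < t" shows "\<Phi> t = top"
proof -
  obtain s where "\<Phi> s = top" "s < t" using assms(2) by (auto simp: b_of_def Inf_less_iff)
  then show ?thesis using Phi_bar_le[OF assms(1), of s t] by (simp add: top_unique)
qed

lemma Phi_bar_top: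
  assumes "\<Phi> \<in> Phi_bar" shows "\<Phi> top = top"
proof (cases "b_of \<Phi> = top")
  case True then show ?thesis using assms by (simp add: Phi_bar_def)
next
  case False then show ?thesis
    using Phi_bar_above_b[OF assms, of top] by (simp add: less_top)
qed

text \<open>Left continuity is available at every t up to and including \<open>b_of \<Phi>\<close>,
  and beyond that point \<Phi> is already infinite slightly to the left of t. The case t =
  \<infinity> is included and yields finite arguments with large values.\<close>

lemma Phi_bar_lower_semicontinuous:
  assumes \<Phi>: "\<Phi> \<in> Phi_bar" and u: "u < \<Phi> t"
  obtains s where "s < t" "u < \<Phi> s"
proof -
  have t: "t > 0" using u Phi_bar_zero[OF \<Phi>] by (cases "t = 0") (auto simp: zero_less_iff_neq_zero)
  show ?thesis
  proof (cases "b_of \<Phi> < t")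
    case True
    then obtain s where "b_of \<Phi> < s" "s < t" using dense by blast
    then show ?thesis using that[of s] Phi_bar_above_b[OF \<Phi>, of s] u by (simp add: order.strict_trans2)
  next
    case False
    then consider "t < b_of \<Phi>" | "t = b_of \<Phi>" by fastforce
    then have "(\<Phi> \<longlongrightarrow> \<Phi> t) (at_left t)"
    proof cases
      case 1 then show ?thesis using \<Phi> by (auto simp: Phi_bar_def)
    next
      case 2
      have *: "b_of \<Phi> = \<infinity> \<longrightarrow> (\<Phi> \<longlongrightarrow> \<Phi> \<infinity>) (at_left \<infinity>)"
        "b_of \<Phi> < \<infinity> \<longrightarrow> (\<Phi> \<longlongrightarrow> \<Phi> (b_of \<Phi>)) (at_left (b_of \<Phi>))"
        using \<Phi> unfolding Phi_bar_def by blast+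
      show ?thesis
        using * 2 by (cases "b_of \<Phi> = \<infinity>") (auto simp: less_top)
    qed
    then have "eventually (\<lambda>s. u < \<Phi> s) (at_left t)"
      using u by (rule order_tendstoD)
    then obtain b where b: "b < t" "\<And>s. b < s \<Longrightarrow> s < t \<Longrightarrow> u < \<Phi> s"
      by (auto simp: eventually_at_left[OF t])
    obtain s where "b < s" "s < t" using dense[OF b(1)] by blast
    then show ?thesis using that b(2) by simp
  qed
qed

lemma Phi_bar_unbounded:
  assumes "\<Phi> \<in> Phi_bar" "u < \<infinity>"
  obtains t :: real where "t > 0" "u < \<Phi> (ennreal t)"
proof -
  have "u < \<Phi> top" using assms by (simp add: Phi_bar_top)
  from Phi_bar_lower_semicontinuous[OF assms(1) this] obtain s where s: "s < top" "u < \<Phi> s" .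
  moreover have "s \<noteq> 0" using s Phi_bar_zero[OF assms(1)] by auto
  ultimately show ?thesis using that[of "enn2real s"]
    by (simp add: enn2real_positive_iff zero_less_iff_neq_zero less_top)
qed

text \<open>The substitute for inverting \<Phi>. With t = \<open>gen_inv \<Phi> u\<close> it gives
  \<Phi> (\<Phi>^-1 u) \<le> u; negated, it turns \<Phi> t \<le> u into t \<le> \<Phi>^-1 u. Left
  continuity enters in the direction from right to left, where it keeps the infimum strictly below
  t.\<close>

lemma gen_inv_less_iff:
  assumes "\<Phi> \<in> Phi_bar" "u < \<infinity>"
  shows "gen_inv \<Phi> u < t \<longleftrightarrow> u < \<Phi> t"
proof
  assume "gen_inv \<Phi> u < t"
  then obtain s where "s < t" "u < \<Phi> s" using assms by (auto simp: gen_inv_def Inf_less_iff split: if_splits)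
  then show "u < \<Phi> t" by (meson Phi_bar_le[OF assms(1)] less_imp_le order.strict_trans2)
next
  assume "u < \<Phi> t"
  then obtain s where "s < t" "u < \<Phi> s" using Phi_bar_lower_semicontinuous assms(1) by metis
  then show "gen_inv \<Phi> u < t" using assms by (auto simp: gen_inv_def Inf_less_iff)
qed

lemma gen_inv_finite:
  assumes "\<Phi> \<in> Phi_bar" "u < \<infinity>" shows "gen_inv \<Phi> u < \<infinity>"
  using assms by (simp add: gen_inv_less_iff Phi_bar_top)

lemma gen_inv_pos:
  assumes \<Phi>: "\<Phi> \<in> Phi_bar" and u: "0 < u" shows "0 < gen_inv \<Phi> u"
proof (cases "u = \<infinity>")
  case True then show ?thesis by (simp add: gen_inv_def)
next
  case False
  have "(\<Phi> \<longlongrightarrow> 0) (at_right 0)" using \<Phi> by (auto simp: Phi_bar_def)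
  then have "eventually (\<lambda>t. \<Phi> t < u) (at_right 0)" using u by (rule order_tendstoD)
  then obtain b where b: "b > 0" "\<And>y. y > 0 \<Longrightarrow> y < b \<Longrightarrow> \<Phi> y < u"
    unfolding eventually_at_right[OF zero_less_one] by blast
  then obtain y where y: "0 < y" "y < b" using dense by blast
  have "\<not> u < \<Phi> y" using b(2)[OF y] by simp
  then have "y \<le> gen_inv \<Phi> u" using gen_inv_less_iff[OF \<Phi>, of u y] False by (simp add: less_top)
  then show ?thesis using y by simp
qed

lemma gen_inv_mono: "mono (gen_inv \<Phi>)"
  unfolding gen_inv_def mono_def
  by (auto intro!: Inf_superset_mono simp: top_unique)

section \<open>Scaling inequalities in place of convexity\<close>

lemma Young_function_scale:
  assumes Y: "\<Psi> \<in> Young_functions" and \<theta>: "\<theta> \<ge> 1"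
  shows "ennreal \<theta> * \<Psi> t \<le> \<Psi> (ennreal (2 * \<theta>) * t)"
proof -
  have \<Psi>: "\<Psi> \<in> Phi_bar" using Y by (auto simp: Young_functions_def)
  have conv: "convex_on {t::real. 0 \<le> t \<and> ennreal t < b_of \<Psi>} (\<lambda>t. enn2real (\<Psi> (ennreal t)))"
    using Y by (auto simp: Young_functions_def)
  consider "t = 0" | "t = top" | "0 < t" "t < top" using less_top not_gr_zero by blast
  then show ?thesis
  proof cases
    case 1 then show ?thesis using Phi_bar_zero[OF \<Psi>] by simp
  next
    case 2 then show ?thesis using Phi_bar_top[OF \<Psi>] \<theta> by (simp add: ennreal_mult_top)
  next
    case 3
    then obtain s where s: "t = ennreal s" "s > 0" by (cases t) auto
    have le: "ennreal (\<theta> * s) < ennreal (2 * \<theta> * s)" using s \<theta> by (simp add: ennreal_less_iff)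
    show ?thesis
    proof (cases "ennreal (\<theta> * s) < b_of \<Psi>")
      case True
      have fin: "\<Psi> (ennreal x) < \<infinity>" if "ennreal x < b_of \<Psi>" for x
        using that Inf_lower[of "ennreal x" "{t. \<Psi> t = \<infinity>}"] unfolding b_of_def
        by (auto simp: less_top[symmetric])
      have "s \<le> \<theta> * s" using s \<theta> by simp
      then have sb: "ennreal s < b_of \<Psi>" using True by (meson ennreal_leI le_less_trans)
      \<comment> \<open>Convexity on the segment from 0 to \<theta> s: the point s has weight
        1/\<theta>, and \<Psi> vanishes at 0.\<close>
      have "enn2real (\<Psi> (ennreal ((1 - 1/\<theta>) *\<^sub>R 0 + (1/\<theta>) *\<^sub>R (\<theta> * s))))
        \<le> (1 - 1/\<theta>) * enn2real (\<Psi> (ennreal 0)) + (1/\<theta>) * enn2real (\<Psi> (ennreal (\<theta> * s)))"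
        using True \<theta> s sb by (intro convex_onD[OF conv]) (auto simp: less_top intro: le_less_trans)
      then have "enn2real (\<Psi> (ennreal s)) \<le> (1/\<theta>) * enn2real (\<Psi> (ennreal (\<theta> * s)))"
        using \<theta> Phi_bar_zero[OF \<Psi>] by simp
      then have "\<theta> * enn2real (\<Psi> (ennreal s)) \<le> enn2real (\<Psi> (ennreal (\<theta> * s)))"
        using \<theta> by (simp add: field_simps)
      then have "ennreal (\<theta> * enn2real (\<Psi> (ennreal s))) \<le> ennreal (enn2real (\<Psi> (ennreal (\<theta> * s))))"
        by (rule ennreal_leI)
      then have "ennreal \<theta> * \<Psi> t \<le> \<Psi> (ennreal (\<theta> * s))"
        using fin[OF True] fin[OF sb] \<theta> s by (simp add: ennreal_mult' less_top)
      also have "\<dots> \<le> \<Psi> (ennreal (2 * \<theta> * s))" using le by (intro Phi_bar_le[OF \<Psi>]) simp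
      finally show ?thesis using s \<theta> by (simp add: ennreal_mult')
    next
      case False
      \<comment> \<open>The factor 2 is spent here. At \<open>b_of \<Psi>\<close> itself the value
        may be finite, but 2 \<theta> s lies strictly beyond, where \<Psi> is infinite.\<close>
      then have "b_of \<Psi> < ennreal (2 * \<theta> * s)" using le by simp
      then show ?thesis using Phi_bar_above_b[OF \<Psi>] s \<theta> by (simp add: ennreal_mult')
    qed
  qed
qed

lemma Phi_bar_Y_scale:
  assumes "\<Phi> \<in> Phi_bar_Y"
  obtains c :: real where "c \<ge> 1" "\<And>\<theta> t. \<theta> \<ge> 1 \<Longrightarrow> ennreal \<theta> * \<Phi> t \<le> \<Phi> (ennreal (c * \<theta>) * t)"
proof -
  obtain \<Psi> C where \<Phi>: "\<Phi> \<in> Phi_bar" and \<Psi>: "\<Psi> \<in> Young_functions" and C: "C > 0"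
    and lo: "\<And>t. \<Phi> (ennreal (1 / C) * t) \<le> \<Psi> t" and hi: "\<And>t. \<Psi> t \<le> \<Phi> (ennreal C * t)"
    using assms unfolding Phi_bar_Y_def Phi_equiv_def by blast
  show ?thesis
  \<comment> \<open>Passing to the Young function and back costs a dilation by C each way, and its
    scaling inequality costs the 2. The maximum secures c \<ge> 1.\<close>
  proof (rule that[of "max 1 (2 * C * C)"])
    fix \<theta> :: real and t assume \<theta>: "\<theta> \<ge> 1"
    have "\<Phi> t \<le> \<Psi> (ennreal C * t)"
      using lo[of "ennreal C * t"] C by (simp add: mult.assoc[symmetric] ennreal_mult'[symmetric])
    then have "ennreal \<theta> * \<Phi> t \<le> ennreal \<theta> * \<Psi> (ennreal C * t)" by (rule mult_left_mono) simp
    also have "\<dots> \<le> \<Psi> (ennreal (2 * \<theta>) * (ennreal C * t))" by (rule Young_function_scale[OF \<Psi> \<theta>])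
    also have "\<dots> \<le> \<Phi> (ennreal C * (ennreal (2 * \<theta>) * (ennreal C * t)))" by (rule hi)
    also have "\<dots> = \<Phi> (ennreal (2 * C * C * \<theta>) * t)"
      using C \<theta> by (simp add: mult.assoc[symmetric] ennreal_mult'[symmetric] ennreal_mult''[symmetric]) (simp add: ac_simps)
    also have "\<dots> \<le> \<Phi> (ennreal (max 1 (2 * C * C) * \<theta>) * t)"
      using \<theta> by (intro Phi_bar_le[OF \<Phi>] mult_right_mono ennreal_leI) auto
    finally show "ennreal \<theta> * \<Phi> t \<le> \<Phi> (ennreal (max 1 (2 * C * C) * \<theta>) * t)" .
  qed simp
qed

lemma Phi_bar_Y_subset: "\<Phi> \<in> Phi_bar_Y \<Longrightarrow> \<Phi> \<in> Phi_bar"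
  by (simp add: Phi_bar_Y_def)

section \<open>Level sets and coverings\<close>

lemma emeasure_lebesgue_ball:
  fixes a :: "'a::euclidean_space"
  assumes "r > 0"
  shows "emeasure lebesgue (ball a r) = ennreal (unit_ball_vol DIM('a) * r ^ DIM('a))"
  using assms emeasure_ball[of r a] by simp

text \<open>Multiplication by m commutes with suprema, so u may be approached from below. It is
  applied with u a value of \<Phi> or \<Psi>, possibly infinite, and leaves a positive real v by
  which one can divide.\<close>

lemma ennreal_mult_leI_dense:
  assumes "\<And>v::real. 0 < v \<Longrightarrow> ennreal v < u \<Longrightarrow> ennreal v * m \<le> (b::ennreal)"
  shows "u * m \<le> b"
proof (rule dense_le)
  fix y assume y: "y < u * m"
  have "u * m = (SUP v\<in>{..<u}. v) * m"
    by (metis Sup_lessThan image_ident)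
  also have "\<dots> = (SUP v\<in>{..<u}. v * m)"
    by (rule SUP_mult_right_ennreal)
  finally have "y < (SUP v\<in>{..<u}. v * m)" using y by simp
  then obtain v where v: "v < u" "y < v * m" by (auto simp: less_SUP_iff)
  then have "v \<noteq> 0" "v < top" by (auto intro: less_le_trans)
  then obtain w where "v = ennreal w" "w > 0" by (cases v) auto
  then show "y \<le> b" using assms[of w] v by simp
qed

text \<open>Vitali's lemma selects disjoint balls whose fivefold dilates cover E. Dilation costs 5^n
  in measure, and disjointness bounds the sum of the integrals of G by its total integral.\<close>

lemma weak_type_covering:
  fixes G :: "'a::euclidean_space \<Rightarrow> ennreal"
  assumes G[measurable]: "G \<in> borel_measurable lebesgue"
    and E: "E \<in> sets lebesgue"
    and cover: "\<And>x. x \<in> E \<Longrightarrow> \<exists>a r. r > 0 \<and> x \<in> ball a r \<and>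
      v * emeasure lebesgue (ball a r) < (\<integral>\<^sup>+y\<in>ball a r. G y \<partial>lebesgue)"
  shows "v * emeasure lebesgue E \<le> 5 ^ DIM('a) * (\<integral>\<^sup>+y. G y \<partial>lebesgue)"
proof -
  define n where "n = DIM('a)"
  define \<omega> where "\<omega> = unit_ball_vol (real DIM('a))"
  have \<omega>: "\<omega> > 0" by (simp add: \<omega>_def)
  have n: "n > 0" by (simp add: n_def)
  have ball: "emeasure lebesgue (ball a r :: 'a set) = ennreal (\<omega> * r ^ n)" if "r > 0" for a r
    using emeasure_lebesgue_ball[OF that] by (simp add: \<omega>_def n_def)
  define I where "I = (\<integral>\<^sup>+y. G y \<partial>lebesgue)"
  have sub: "(\<integral>\<^sup>+y\<in>ball a r. G y \<partial>lebesgue) \<le> I" for a r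
    unfolding I_def by (intro nn_integral_mono) (auto simp: indicator_def)
  consider "I = top" | "v = 0" | "E = {}" | "I < top" "v \<noteq> 0" "E \<noteq> {}"
    using top.not_eq_extremum by blast
  then have "v * emeasure lebesgue E \<le> 5 ^ n * I"
  proof cases
    case 1 then show ?thesis by (simp add: ennreal_mult_top)
  next
    case 4
    obtain a r where ar: "\<And>x. x \<in> E \<Longrightarrow> r x > 0" "\<And>x. x \<in> E \<Longrightarrow> x \<in> ball (a x) (r x)"
      "\<And>x. x \<in> E \<Longrightarrow> v * emeasure lebesgue (ball (a x) (r x)) < (\<integral>\<^sup>+y\<in>ball (a x) (r x). G y \<partial>lebesgue)"
      using cover by metis
    have lt: "v * ennreal (\<omega> * r x ^ n) < I" if "x \<in> E" for x
      using ar(3)[OF that] sub[of "a x" "r x"] ball[OF ar(1)[OF that], of "a x"] by (simp add: less_le_trans)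
    have "v < top"
    proof (rule ccontr)
      assume "\<not> v < top"
      moreover obtain x where "x \<in> E" using 4 by blast
      ultimately show False using lt[of x] ar(1)[of x] \<omega> by (simp add: less_top[symmetric] ennreal_top_mult)
    qed
    then obtain w where w: "v = ennreal w" "w > 0" using 4 by (cases v) auto
    obtain J where J: "I = ennreal J" "J \<ge> 0" using 4 by (cases I) auto
    \<comment> \<open>Vitali's lemma needs uniformly bounded radii. The bound comes from v |B| < I
      with I finite; the 1 covers radii below 1, which need not satisfy r \<le> r^n.\<close>
    have bnd: "0 < r x \<and> r x \<le> max 1 (J / (w * \<omega>))" if "x \<in> E" for x
    proof -
      have "w * (\<omega> * r x ^ n) < J"
        using lt[OF that] w J \<omega> ar(1)[OF that] by (simp add: ennreal_mult'[symmetric] ennreal_less_iff)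
      then have "r x ^ n \<le> J / (w * \<omega>)" using w \<omega> by (simp add: field_simps)
      moreover have "r x \<le> r x ^ n" if "r x \<ge> 1" using that n by (simp add: self_le_power)
      ultimately show ?thesis using ar(1)[OF that] by (cases "r x \<ge> 1") auto
    qed
    have "E \<subseteq> (\<Union>x\<in>E. ball (a x) (r x))" using ar(2) by blast
    from Vitali_covering_lemma_balls[OF this bnd]
    obtain C where C: "countable C" "C \<subseteq> E"
      "pairwise (\<lambda>i j. disjnt (ball (a i) (r i)) (ball (a j) (r j))) C"
      "E \<subseteq> (\<Union>i\<in>C. ball (a i) (5 * r i))" by blast
    have "emeasure lebesgue E = (\<integral>\<^sup>+y. indicator E y \<partial>lebesgue)" using E by simp
    also have "\<dots> \<le> (\<integral>\<^sup>+y. (\<integral>\<^sup>+i. indicator (ball (a i) (5 * r i)) y \<partial>count_space C) \<partial>lebesgue)"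
    proof (rule nn_integral_mono)
      fix y
      show "(indicator E y :: ennreal) \<le> (\<integral>\<^sup>+i. indicator (ball (a i) (5 * r i)) y \<partial>count_space C)"
      proof (cases "y \<in> E")
        case True
        then obtain i where i: "i \<in> C" "y \<in> ball (a i) (5 * r i)" using C(4) by blast
        have "(1::ennreal) = indicator (ball (a i) (5 * r i)) y" using i by simp
        also have "\<dots> \<le> (\<integral>\<^sup>+i. indicator (ball (a i) (5 * r i)) y \<partial>count_space C)"
          by (rule nn_integral_ge_point[OF i(1)])
        finally show ?thesis using True by simp
      qed simp
    qed
    also have "\<dots> = (\<integral>\<^sup>+i. emeasure lebesgue (ball (a i) (5 * r i)) \<partial>count_space C)"
      by (subst nn_integral_count_space_nn_integral[OF C(1)]) (auto intro!: borel_measurable_indicator)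
    also have "\<dots> = (\<integral>\<^sup>+i. 5 ^ n * emeasure lebesgue (ball (a i) (r i)) \<partial>count_space C)"
    proof (rule nn_integral_cong)
      fix i assume "i \<in> space (count_space C)"
      then have "r i > 0" using C(2) ar(1) by auto
      then have "emeasure lebesgue (ball (a i) (5 * r i)) = ennreal (5 ^ n * (\<omega> * r i ^ n))"
        by (subst ball) (simp_all add: power_mult_distrib mult_ac)
      also have "\<dots> = ennreal (5 ^ n) * ennreal (\<omega> * r i ^ n)" by (intro ennreal_mult') simp
      also have "ennreal (5 ^ n) = 5 ^ n" by (simp add: ennreal_power[symmetric])
      finally show "emeasure lebesgue (ball (a i) (5 * r i)) = 5 ^ n * emeasure lebesgue (ball (a i) (r i))"
        by (simp only: ball[OF \<open>r i > 0\<close>])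
    qed
    also have "\<dots> = 5 ^ n * (\<integral>\<^sup>+i. emeasure lebesgue (ball (a i) (r i)) \<partial>count_space C)"
      by (rule nn_integral_cmult) simp
    finally have "v * emeasure lebesgue E \<le> v * (5 ^ n * (\<integral>\<^sup>+i. emeasure lebesgue (ball (a i) (r i)) \<partial>count_space C))"
      by (rule mult_left_mono) simp
    also have "\<dots> = 5 ^ n * (\<integral>\<^sup>+i. v * emeasure lebesgue (ball (a i) (r i)) \<partial>count_space C)"
      by (subst nn_integral_cmult) (simp_all add: mult_ac)
    \<comment> \<open>Integration of G is viewed as a measure, so that the sum over disjoint balls
      becomes the measure of their union.\<close>
    also have "(\<integral>\<^sup>+i. v * emeasure lebesgue (ball (a i) (r i)) \<partial>count_space C)
      \<le> (\<integral>\<^sup>+i. emeasure (density lebesgue G) (ball (a i) (r i)) \<partial>count_space C)"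
      using C(2) ar(3) by (intro nn_integral_mono) (auto simp: emeasure_density intro: less_imp_le)
    also have "\<dots> = emeasure (density lebesgue G) (\<Union>i\<in>C. ball (a i) (r i))"
      using C(3) by (intro emeasure_UN_countable[symmetric] C(1))
        (auto simp: disjoint_family_on_def pairwise_def disjnt_def)
    also have "\<dots> \<le> emeasure (density lebesgue G) UNIV"
      by (rule emeasure_mono) auto
    also have "\<dots> = I" by (simp add: emeasure_density I_def)
    finally show ?thesis by (simp add: mult_left_mono)
  qed auto
  then show ?thesis by (simp add: n_def I_def)
qed

lemma sets_superlevel:
  fixes g :: "'a::euclidean_space \<Rightarrow> ennreal"
  assumes [measurable]: "g \<in> borel_measurable lebesgue"
  shows "{x. c < g x} \<in> sets lebesgue"
proof -
  have "{x \<in> space lebesgue. c < g x} \<in> sets lebesgue" by measurable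
  then show ?thesis by simp
qed

section \<open>Sums over geometric levels and tails under the nabla-2 condition\<close>

lemma geometric_truncation:
  fixes g :: ennreal
  assumes k: "k > 1" and T: "T > 0" and g: "ennreal T < g"
  shows "g \<le> (\<Sum>j. ennreal (k ^ Suc j * T) * indicator {ennreal (k ^ j * T)<..} g)" (is "_ \<le> ?S")
proof (rule ccontr)
  assume "\<not> g \<le> ?S"
  then have S: "?S < g" by simp
  have term_le: "ennreal (k ^ Suc j * T) \<le> ?S" if "ennreal (k ^ j * T) < g" for j
    using that sum_le_suminf[of "\<lambda>j. ennreal (k ^ Suc j * T) * indicator {ennreal (k ^ j * T)<..} g" "{j}"] by simp
  \<comment> \<open>If g exceeds level j, the sum contains level j + 1 as a term; being below g, it
    forces g to exceed level j + 1 too. Hence every level occurs and the sum cannot be finite. This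
    also covers infinite g.\<close>
  have all: "ennreal (k ^ j * T) < g" for j
  proof (induction j)
    case 0 then show ?case using g by simp
  next
    case (Suc j) then show ?case using term_le[OF Suc] S by simp
  qed
  obtain s where s: "?S = ennreal s" "s \<ge> 0" using S by (cases ?S) auto
  obtain j where "s / T < k ^ j" using real_arch_pow[OF k] by blast
  then have "s < k ^ j * T" using T by (simp add: field_simps)
  also have "\<dots> \<le> k ^ Suc j * T" using k T by simp
  finally show False using term_le[OF all, of j] s by (simp add: ennreal_le_iff)
qed

lemma nabla2_bar_iterate:
  assumes \<Phi>: "\<Phi> \<in> nabla2_bar"
  obtains k :: real where "k > 1" "\<And>j t. ennreal ((2 * k) ^ j) * \<Phi> t \<le> \<Phi> (ennreal (k ^ j) * t)"
proof -
  obtain k where k: "k > 1" and *: "\<And>t. t > 0 \<Longrightarrow> \<Phi> t \<le> ennreal (1 / (2 * k)) * \<Phi> (ennreal k * t)"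
    and \<Phi>0: "\<Phi> 0 = 0"
    using \<Phi> unfolding nabla2_bar_def Phi_bar_def by blast
  have step: "ennreal (2 * k) * \<Phi> t \<le> \<Phi> (ennreal k * t)" for t
  proof (cases "t = 0")
    case False
    have "ennreal (2 * k) * \<Phi> t \<le> ennreal (2 * k) * (ennreal (1 / (2 * k)) * \<Phi> (ennreal k * t))"
      using False by (intro mult_left_mono *) (auto simp: zero_less_iff_neq_zero)
    also have "\<dots> = \<Phi> (ennreal k * t)"
      using k by (simp add: mult.assoc[symmetric] ennreal_mult'[symmetric])
    finally show ?thesis .
  qed (simp add: \<Phi>0)
  show ?thesis
  proof (rule that[OF k])
    fix j t
    show "ennreal ((2 * k) ^ j) * \<Phi> t \<le> \<Phi> (ennreal (k ^ j) * t)"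
    proof (induction j)
      case (Suc j)
      have "ennreal ((2 * k) ^ Suc j) * \<Phi> t = ennreal (2 * k) * (ennreal ((2 * k) ^ j) * \<Phi> t)"
        using k by (simp only: power_Suc) (subst ennreal_mult, simp_all add: mult.assoc)
      also have "\<dots> \<le> ennreal (2 * k) * \<Phi> (ennreal (k ^ j) * t)" by (rule mult_left_mono[OF Suc]) simp
      also have "\<dots> \<le> \<Phi> (ennreal k * (ennreal (k ^ j) * t))" by (rule step)
      also have "\<dots> = \<Phi> (ennreal (k ^ Suc j) * t)"
        using k by (simp add: mult.assoc ennreal_mult)
      finally show ?case .
    qed simp
  qed
qed

text \<open>The admissibility condition of the weak norm, with the supremum unfolded into one bound
  per level. It is stated for \<open>ennreal\<close>-valued functions so that it applies directly to
  maximal functions; \<open>weak_orlicz_norm_eq\<close> makes the link.\<close>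

definition weak_modular_le_1 :: "(ennreal \<Rightarrow> ennreal) \<Rightarrow> ('a::euclidean_space \<Rightarrow> ennreal) \<Rightarrow> bool" where
  "weak_modular_le_1 \<Phi> g \<longleftrightarrow> (\<forall>t>0. \<Phi> (ennreal t) * emeasure lebesgue {x. ennreal t < g x} \<le> 1)"

text \<open>The set above level k^j T has measure at most 1 / ((2k)^j v), while its weight is
  k^(j+1) T. The product is (k T / v) 2^-j, and the series sums to 2 k T / v. Without the factor 2
  from the nabla-2 inequality the terms would not decay.\<close>

lemma weak_modular_tail:
  fixes g :: "'a::euclidean_space \<Rightarrow> ennreal"
  assumes g[measurable]: "g \<in> borel_measurable lebesgue" and W: "weak_modular_le_1 \<Phi> g"
    and k: "k > 1" and iter: "\<And>j t. ennreal ((2 * k) ^ j) * \<Phi> t \<le> \<Phi> (ennreal (k ^ j) * t)"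
    and T: "T > 0" and v: "v > 0" "ennreal v \<le> \<Phi> (ennreal T)"
  shows "(\<integral>\<^sup>+x. g x * indicator {x. ennreal T < g x} x \<partial>lebesgue) \<le> ennreal (2 * k * T / v)"
proof -
  define m where "m j = emeasure lebesgue {x. ennreal (k ^ j * T) < g x}" for j
  have m: "m j \<le> ennreal (1 / ((2 * k) ^ j * v))" for j
  proof -
    have "ennreal ((2 * k) ^ j * v) = ennreal ((2 * k) ^ j) * ennreal v"
      using k v by (intro ennreal_mult) auto
    also have "\<dots> \<le> ennreal ((2 * k) ^ j) * \<Phi> (ennreal T)"
      by (rule mult_left_mono[OF v(2)]) simp
    also have "\<dots> \<le> \<Phi> (ennreal (k ^ j * T))"
      using iter[of j "ennreal T"] k T by (simp add: ennreal_mult)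
    finally have "ennreal ((2 * k) ^ j * v) * m j \<le> \<Phi> (ennreal (k ^ j * T)) * m j"
      by (rule mult_right_mono) simp
    also have "\<dots> \<le> 1" using W k T unfolding weak_modular_le_1_def m_def by simp
    finally have "ennreal (1 / ((2 * k) ^ j * v)) * (ennreal ((2 * k) ^ j * v) * m j) \<le> ennreal (1 / ((2 * k) ^ j * v)) * 1"
      by (rule mult_left_mono) simp
    then show ?thesis using k v by (simp add: mult.assoc[symmetric] ennreal_mult'[symmetric])
  qed
  have "(\<integral>\<^sup>+x. g x * indicator {x. ennreal T < g x} x \<partial>lebesgue)
    \<le> (\<integral>\<^sup>+x. (\<Sum>j. ennreal (k ^ Suc j * T) * indicator {x. ennreal (k ^ j * T) < g x} x) \<partial>lebesgue)"
    using geometric_truncation[OF k T] by (intro nn_integral_mono) (auto simp: indicator_def)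
  also have "\<dots> = (\<Sum>j. ennreal (k ^ Suc j * T) * m j)"
    by (subst nn_integral_suminf) (auto simp: nn_integral_cmult_indicator m_def sets_superlevel[OF g])
  also have "\<dots> \<le> (\<Sum>j. ennreal (k * T / v * (1 / 2) ^ j))"
  proof (rule suminf_le)
    fix j
    have "ennreal (k ^ Suc j * T) * m j \<le> ennreal (k ^ Suc j * T) * ennreal (1 / ((2 * k) ^ j * v))"
      by (rule mult_left_mono[OF m]) simp
    also have "\<dots> = ennreal (k ^ Suc j * T * (1 / ((2 * k) ^ j * v)))"
      using k T by (intro ennreal_mult'[symmetric]) simp
    also have "k ^ Suc j * T * (1 / ((2 * k) ^ j * v)) = k * T / v * (1 / 2) ^ j"
      using k v by (simp add: field_simps power_mult_distrib)
    finally show "ennreal (k ^ Suc j * T) * m j \<le> ennreal (k * T / v * (1 / 2) ^ j)" .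
  qed auto
  also have "\<dots> = ennreal (2 * k * T / v)"
  proof (rule suminf_ennreal_eq)
    show "(\<lambda>j. k * T / v * (1 / 2) ^ j) sums (2 * k * T / v)"
      using sums_mult[OF geometric_sums[of "1/2::real"], of "k * T / v"] by (simp add: mult_ac)
  qed (use k T v in auto)
  finally show ?thesis .
qed

lemma scale_pointwise:
  assumes \<Phi>: "\<Phi> \<in> Phi_bar" and c: "c \<ge> 1" "\<And>\<theta> t. \<theta> \<ge> 1 \<Longrightarrow> ennreal \<theta> * \<Phi> t \<le> \<Phi> (ennreal (c * \<theta>) * t)"
    and T: "T > 0" and v: "v > 0" "ennreal v \<le> \<Phi> (ennreal T)"
  shows "g \<le> ennreal (c * T) + ennreal (c * T / v) * \<Phi> g"
proof -
  consider "g \<le> ennreal (c * T)" | "g = top" | x where "g = ennreal x" "c * T < x"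
  proof (cases g)
    case (real x)
    then show thesis using that by (cases "x \<le> c * T") (auto simp: ennreal_leI)
  qed (use that in blast)
  then show ?thesis
  proof cases
    case 1 then show ?thesis by (simp add: add_increasing2)
  next
    case 2 then show ?thesis using c T v by (simp add: Phi_bar_top[OF \<Phi>] ennreal_mult_top)
  next
    case 3
    \<comment> \<open>Chosen so that g = c \<theta> T. The scaling inequality then gives \<Phi> g
      \<ge> \<theta> \<Phi> T \<ge> \<theta> v, and c T / v times \<theta> v is g.\<close>
    define \<theta> where "\<theta> = x / (c * T)"
    have \<theta>: "\<theta> \<ge> 1" "x = c * \<theta> * T" using 3 c T by (auto simp: \<theta>_def field_simps)
    have "g = ennreal (c * T / v) * (ennreal \<theta> * ennreal v)"
      using \<theta> c T v 3 by (simp add: ennreal_mult'[symmetric] field_simps)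
    also have "\<dots> \<le> ennreal (c * T / v) * (ennreal \<theta> * \<Phi> (ennreal T))"
      by (intro mult_left_mono v) auto
    also have "\<dots> \<le> ennreal (c * T / v) * \<Phi> g"
      using c(2)[OF \<theta>(1), of "ennreal T"] \<theta> c 3 by (intro mult_left_mono) (auto simp: ennreal_mult'[symmetric])
    finally show ?thesis by (simp add: add_increasing)
  qed
qed

section \<open>Pointwise bounds for maximal functions\<close>

lemma less_divide_ennreal_iff:
  fixes a b c :: ennreal
  assumes "b \<noteq> 0" "b \<noteq> top"
  shows "c < a / b \<longleftrightarrow> c * b < a"
proof -
  have "a / b * b = a"
    using assms by (simp add: ennreal_divide_times top.not_eq_extremum)
  then have "a \<le> c * b \<longleftrightarrow> b * (a / b) \<le> b * c" by (simp add: mult.commute)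
  also have "\<dots> \<longleftrightarrow> a / b \<le> c" using assms by (rule ennreal_mult_le_mult_iff)
  finally show ?thesis by (simp add: not_le[symmetric])
qed

lemma divide_le_ennreal_iff:
  fixes a b c :: ennreal
  assumes "b \<noteq> 0" "b \<noteq> top"
  shows "a / b \<le> c \<longleftrightarrow> a \<le> c * b"
  using less_divide_ennreal_iff[OF assms, of c a] by (simp add: not_less[symmetric])

lemma e2ennreal_abs_divide:
  assumes "l > 0" shows "e2ennreal (\<bar>x\<bar> / ereal l) = e2ennreal \<bar>x\<bar> / ennreal l"
  using assms by (cases x) (simp_all add: divide_ennreal ennreal_top_divide)

lemma ball_measure_pos:
  fixes a :: "'a::euclidean_space"
  assumes "r > 0"
  shows "emeasure lebesgue (ball a r) \<noteq> 0" "emeasure lebesgue (ball a r) \<noteq> top"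
  using assms emeasure_lebesgue_ball[OF assms, of a] by (simp_all add: ennreal_eq_0_iff not_le)

lemma less_frac_maximal_iff:
  "t < frac_maximal \<rho> f x \<longleftrightarrow> (\<exists>a r. r > 0 \<and> x \<in> ball a r \<and>
     t < ennreal (\<rho> r) * ((\<integral>\<^sup>+y\<in>ball a r. e2ennreal \<bar>f y\<bar> \<partial>lebesgue) / emeasure lebesgue (ball a r)))"
  unfolding frac_maximal_def less_SUP_iff by auto

lemma frac_maximal_upper:
  assumes "r > 0" "x \<in> ball a r"
  shows "ennreal (\<rho> r) * ((\<integral>\<^sup>+y\<in>ball a r. e2ennreal \<bar>f y\<bar> \<partial>lebesgue) / emeasure lebesgue (ball a r))
    \<le> frac_maximal \<rho> f x"
  unfolding frac_maximal_def by (rule SUP_upper2[of "(a, r)"]) (use assms in auto)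

text \<open>The balls need not be centred at x, so a ball that witnesses the inequality at x does so
  at all its points. Superlevel sets are therefore unions of open balls.\<close>

lemma frac_maximal_measurable:
  fixes f :: "'n::finite fn"
  shows "frac_maximal \<rho> f \<in> borel_measurable lebesgue"
proof (rule borel_measurableI_greater)
  fix t
  have "{x. t < frac_maximal \<rho> f x} = \<Union>{ball a r |a r. r > 0 \<and>
     t < ennreal (\<rho> r) * ((\<integral>\<^sup>+y\<in>ball a r. e2ennreal \<bar>f y\<bar> \<partial>lebesgue) / emeasure lebesgue (ball a r))}"
    unfolding less_frac_maximal_iff by blast
  also have "open \<dots>" by (intro open_Union) auto
  finally have "{x. t < frac_maximal \<rho> f x} \<in> sets lebesgue" by (intro sets_completionI_sets) simp
  then show "{x \<in> space lebesgue. t < frac_maximal \<rho> f x} \<in> sets lebesgue" by simp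
qed

text \<open>The strict inequality produces a single ball, with the division cleared: the shape of
  the covering hypothesis of \<open>weak_type_covering\<close>.\<close>

lemma less_HL_maximal_divide_iff:
  fixes f :: "'n::finite fn"
  assumes l: "l > 0" and f[measurable]: "f \<in> borel_measurable lebesgue"
  shows "s < HL_maximal f x / ennreal l \<longleftrightarrow> (\<exists>a r. r > 0 \<and> x \<in> ball a r \<and>
    s * emeasure lebesgue (ball a r) < (\<integral>\<^sup>+y\<in>ball a r. (e2ennreal \<bar>f y\<bar> / ennreal l) \<partial>lebesgue))"
proof -
  have [measurable]: "ball a r \<in> sets lebesgue" for a :: "real ^ 'n" and r by simp
  have l': "ennreal l \<noteq> 0" "ennreal l \<noteq> top" using l by simp_all
  have "s * ennreal l < (\<integral>\<^sup>+y\<in>ball a r. e2ennreal \<bar>f y\<bar> \<partial>lebesgue) / emeasure lebesgue (ball a r) \<longleftrightarrow>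
    s * emeasure lebesgue (ball a r) < (\<integral>\<^sup>+y\<in>ball a r. (e2ennreal \<bar>f y\<bar> / ennreal l) \<partial>lebesgue)"
    if "r > 0" for a r
  proof -
    have "(\<integral>\<^sup>+y\<in>ball a r. (e2ennreal \<bar>f y\<bar> / ennreal l) \<partial>lebesgue)
      = (\<integral>\<^sup>+y. e2ennreal \<bar>f y\<bar> * indicator (ball a r) y / ennreal l \<partial>lebesgue)"
      by (simp add: ennreal_divide_times ennreal_times_divide mult.commute)
    also have "\<dots> = (\<integral>\<^sup>+y\<in>ball a r. e2ennreal \<bar>f y\<bar> \<partial>lebesgue) / ennreal l"
      by (rule nn_integral_divide) measurable
    finally show ?thesis
      using less_divide_ennreal_iff[OF l'] less_divide_ennreal_iff[OF ball_measure_pos[OF that, of a]]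
      by (simp add: mult_ac)
  qed
  then show ?thesis
    by (simp add: less_divide_ennreal_iff[OF l'] less_frac_maximal_iff cong: conj_cong)
qed

text \<open>S may be empty, with infimum \<infinity>; a nonzero b keeps the right side infinite in
  that case.\<close>

lemma le_mult_INF_ennreal:
  fixes b :: ennreal
  assumes "\<And>l. l \<in> S \<Longrightarrow> A \<le> b * ennreal l" "b \<noteq> 0" "b \<noteq> top"
  shows "A \<le> b * (INF l\<in>S. ennreal l)"
proof -
  have "A / b \<le> (INF l\<in>S. ennreal l)"
    using assms by (intro INF_greatest) (simp add: divide_le_ennreal_iff mult.commute)
  then show ?thesis using assms by (simp add: divide_le_ennreal_iff mult.commute)
qed

lemma Phi_bar_measurable:
  assumes \<Phi>: "\<Phi> \<in> Phi_bar" shows "\<Phi> \<in> borel_measurable borel"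
proof (rule borel_measurableI_greater)
  fix u
  have "{t. u < \<Phi> t} = (if u = top then {} else {gen_inv \<Phi> u<..})"
    using gen_inv_less_iff[OF \<Phi>, of u] by (auto simp: less_top)
  then show "{t \<in> space borel. u < \<Phi> t} \<in> sets borel" by simp
qed

text \<open>The common interface of the strong and the weak unit ball: g is bounded by a multiple of
  the level T up to an integrable remainder G. The real v stands in for \<Phi> T, which may be
  infinite.\<close>

definition splits_at_levels :: "(ennreal \<Rightarrow> ennreal) \<Rightarrow> real \<Rightarrow> ('a::euclidean_space \<Rightarrow> ennreal) \<Rightarrow> bool" where
  "splits_at_levels \<Phi> \<kappa> g \<longleftrightarrow> (\<forall>T>0. \<forall>v>0. ennreal v \<le> \<Phi> (ennreal T) \<longrightarrow>
     (\<exists>G \<in> borel_measurable lebesgue. (\<forall>y. g y \<le> ennreal (\<kappa> * T) + G y) \<and>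
        (\<integral>\<^sup>+y. G y \<partial>lebesgue) \<le> ennreal (\<kappa> * T / v)))"

lemma splits_at_levelsE:
  assumes "splits_at_levels \<Phi> \<kappa> g" "T > 0" "v > 0" "ennreal v \<le> \<Phi> (ennreal T)"
  obtains G where "G \<in> borel_measurable lebesgue" "\<And>y. g y \<le> ennreal (\<kappa> * T) + G y"
    "(\<integral>\<^sup>+y. G y \<partial>lebesgue) \<le> ennreal (\<kappa> * T / v)"
  using assms unfolding splits_at_levels_def by blast

lemma splits_at_levels_modular:
  fixes g :: "'a::euclidean_space \<Rightarrow> ennreal"
  assumes \<Phi>: "\<Phi> \<in> Phi_bar" and c: "c \<ge> 1" "\<And>\<theta> t. \<theta> \<ge> 1 \<Longrightarrow> ennreal \<theta> * \<Phi> t \<le> \<Phi> (ennreal (c * \<theta>) * t)"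
    and g[measurable]: "g \<in> borel_measurable lebesgue"
    and mod: "(\<integral>\<^sup>+y. \<Phi> (g y) \<partial>lebesgue) \<le> 1"
  shows "splits_at_levels \<Phi> c g"
  unfolding splits_at_levels_def
proof (intro allI impI)
  fix T v :: real assume T: "T > 0" and v: "v > 0" "ennreal v \<le> \<Phi> (ennreal T)"
  have [measurable]: "\<Phi> \<in> borel_measurable borel" by (rule Phi_bar_measurable[OF \<Phi>])
  have "(\<integral>\<^sup>+y. ennreal (c * T / v) * \<Phi> (g y) \<partial>lebesgue) = ennreal (c * T / v) * (\<integral>\<^sup>+y. \<Phi> (g y) \<partial>lebesgue)"
    by (rule nn_integral_cmult) measurable
  also have "\<dots> \<le> ennreal (c * T / v) * 1" by (rule mult_left_mono[OF mod]) simp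
  finally show "\<exists>G \<in> borel_measurable lebesgue. (\<forall>y. g y \<le> ennreal (c * T) + G y) \<and>
        (\<integral>\<^sup>+y. G y \<partial>lebesgue) \<le> ennreal (c * T / v)"
    using scale_pointwise[OF \<Phi> c T v] by (intro bexI[of _ "\<lambda>y. ennreal (c * T / v) * \<Phi> (g y)"]) auto
qed

lemma splits_at_levels_weak_modular:
  fixes g :: "'a::euclidean_space \<Rightarrow> ennreal"
  assumes k: "k > 1" "\<And>j t. ennreal ((2 * k) ^ j) * \<Phi> t \<le> \<Phi> (ennreal (k ^ j) * t)"
    and g[measurable]: "g \<in> borel_measurable lebesgue"
    and W: "weak_modular_le_1 \<Phi> g"
  shows "splits_at_levels \<Phi> (2 * k) g"
  unfolding splits_at_levels_def
proof (intro allI impI)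
  fix T v :: real assume T: "T > 0" and v: "v > 0" "ennreal v \<le> \<Phi> (ennreal T)"
  have [measurable]: "{x. ennreal T < g x} \<in> sets lebesgue" by (rule sets_superlevel[OF g])
  have "g y \<le> ennreal (2 * k * T) + g y * indicator {x. ennreal T < g x} y" for y
  proof (cases "ennreal T < g y")
    case False
    then have "g y \<le> ennreal T" by simp
    also have "\<dots> \<le> ennreal (2 * k * T)" using k T by (intro ennreal_leI) simp
    finally show ?thesis by (simp add: add_increasing2)
  qed (simp add: add_increasing)
  then show "\<exists>G \<in> borel_measurable lebesgue. (\<forall>y. g y \<le> ennreal (2 * k * T) + G y) \<and>
        (\<integral>\<^sup>+y. G y \<partial>lebesgue) \<le> ennreal (2 * k * T / v)"
    using weak_modular_tail[OF g W k T v]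
    by (intro bexI[of _ "\<lambda>y. g y * indicator {x. ennreal T < g x} y"]) auto
qed

lemma ball_integral_le_split:
  fixes g G :: "'a::euclidean_space \<Rightarrow> ennreal"
  assumes [measurable]: "G \<in> borel_measurable lebesgue" and le: "\<And>y. g y \<le> \<sigma> + G y"
  shows "(\<integral>\<^sup>+y\<in>ball a r. g y \<partial>lebesgue) \<le> \<sigma> * emeasure lebesgue (ball a r) + (\<integral>\<^sup>+y\<in>ball a r. G y \<partial>lebesgue)"
proof -
  have [measurable]: "ball a r \<in> sets lebesgue" by simp
  have "(\<integral>\<^sup>+y\<in>ball a r. g y \<partial>lebesgue) \<le> (\<integral>\<^sup>+y. \<sigma> * indicator (ball a r) y + G y * indicator (ball a r) y \<partial>lebesgue)"
    using le by (intro nn_integral_mono) (auto simp: indicator_def)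
  also have "\<dots> = \<sigma> * emeasure lebesgue (ball a r) + (\<integral>\<^sup>+y\<in>ball a r. G y \<partial>lebesgue)"
    by (subst nn_integral_add) (simp_all add: nn_integral_cmult_indicator del: emeasure_completion)
  finally show ?thesis .
qed

section \<open>Ball averages and Hedberg's inequality\<close>

lemma ball_average_le_gen_inv:
  fixes g :: "'a::euclidean_space \<Rightarrow> ennreal"
  assumes \<Phi>: "\<Phi> \<in> Phi_bar" and \<kappa>: "\<kappa> > 0" and r: "r > 0"
    and split: "splits_at_levels \<Phi> \<kappa> g"
  shows "(\<integral>\<^sup>+y\<in>ball a r. g y \<partial>lebesgue) / emeasure lebesgue (ball a r)
    \<le> ennreal (\<kappa> * (1 + 1 / unit_ball_vol DIM('a))) * gen_inv \<Phi> (ennreal (1 / r ^ DIM('a)))"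
    (is "?avg \<le> ennreal ?\<kappa>' * gen_inv \<Phi> ?u")
proof -
  define \<omega> where "\<omega> = unit_ball_vol (real DIM('a))"
  have \<omega>: "\<omega> > 0" by (simp add: \<omega>_def)
  have B: "emeasure lebesgue (ball a r) = ennreal (\<omega> * r ^ DIM('a))"
    using emeasure_lebesgue_ball[OF r, of a] by (simp add: \<omega>_def)
  have \<kappa>': "?\<kappa>' > 0" using \<kappa> \<omega> by (simp add: \<omega>_def[symmetric] add_pos_pos)
  then have \<kappa>'_ennreal: "ennreal ?\<kappa>' \<noteq> 0" "ennreal ?\<kappa>' \<noteq> top" by (simp_all add: ennreal_eq_0_iff not_le)
  \<comment> \<open>Every T with \<Phi> T > 1 / r^n can be used, with v = 1 / r^n. The level part
    adds \<kappa> T to the average; the remainder has integral at most \<kappa> T r^n and, divided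
    by \<omega> r^n, adds \<kappa> T / \<omega>. The infimum over such T is
    \<open>gen_inv\<close>.\<close>
  have "?avg / ennreal ?\<kappa>' \<le> T" if T: "?u < \<Phi> T" for T
  proof (cases T)
    case (real t)
    have "T \<noteq> 0" using T Phi_bar_zero[OF \<Phi>] by auto
    then have t: "t > 0" using real by auto
    obtain G where G: "G \<in> borel_measurable lebesgue" "\<And>y. g y \<le> ennreal (\<kappa> * t) + G y"
      "(\<integral>\<^sup>+y. G y \<partial>lebesgue) \<le> ennreal (\<kappa> * t / (1 / r ^ DIM('a)))"
      using T real t r by (auto intro: splits_at_levelsE[OF split t, of "1 / r ^ DIM('a)"])
    have "(\<integral>\<^sup>+y\<in>ball a r. g y \<partial>lebesgue) \<le> ennreal (\<kappa> * t) * emeasure lebesgue (ball a r) + (\<integral>\<^sup>+y\<in>ball a r. G y \<partial>lebesgue)"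
      by (rule ball_integral_le_split[OF G(1,2)])
    also have "(\<integral>\<^sup>+y\<in>ball a r. G y \<partial>lebesgue) \<le> (\<integral>\<^sup>+y. G y \<partial>lebesgue)"
      by (intro nn_integral_mono) (auto simp: indicator_def)
    also have "\<dots> \<le> ennreal (\<kappa> * t / (1 / r ^ DIM('a)))" by (rule G(3))
    finally have "(\<integral>\<^sup>+y\<in>ball a r. g y \<partial>lebesgue) \<le> ennreal (\<kappa> * t) * emeasure lebesgue (ball a r) + ennreal (\<kappa> * t / (1 / r ^ DIM('a)))"
      by (simp add: add_left_mono)
    also have "\<dots> = ennreal (\<kappa> * t * (\<omega> * r ^ DIM('a)) + \<kappa> * t / (1 / r ^ DIM('a)))"
      using \<kappa> t \<omega> r by (simp add: B ennreal_mult'[symmetric] ennreal_plus[symmetric] del: ennreal_plus)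
    also have "\<kappa> * t * (\<omega> * r ^ DIM('a)) + \<kappa> * t / (1 / r ^ DIM('a)) = t * (\<kappa> * (1 + 1 / \<omega>)) * (\<omega> * r ^ DIM('a))"
      using \<omega> by (simp add: field_simps)
    also have "ennreal \<dots> = ennreal t * ennreal ?\<kappa>' * emeasure lebesgue (ball a r)"
      using \<kappa>' t \<omega> r by (simp add: B ennreal_mult'[symmetric] \<omega>_def[symmetric])
    finally show ?thesis
      by (simp only: divide_le_ennreal_iff[OF \<kappa>'_ennreal] divide_le_ennreal_iff[OF ball_measure_pos[OF r]] real)
  qed simp
  then have "?avg / ennreal ?\<kappa>' \<le> gen_inv \<Phi> ?u"
    unfolding gen_inv_def by (auto intro!: Inf_greatest)
  then show ?thesis by (simp only: divide_le_ennreal_iff[OF \<kappa>'_ennreal] mult.commute)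
qed

lemma frac_maximal_hedberg:
  fixes f :: "'n::finite fn"
  assumes \<Phi>: "\<Phi> \<in> Phi_bar" and \<Psi>: "\<Psi> \<in> Phi_bar"
    and cond: "sup_rho_condition CARD('n) \<rho> \<Phi> \<Psi> A" and A: "A > 0"
    and C0: "C0 > 0" and N: "N \<noteq> 0" "N \<noteq> top"
    and avg: "\<And>a r. r > 0 \<Longrightarrow> (\<integral>\<^sup>+y\<in>ball a r. e2ennreal \<bar>f y\<bar> \<partial>lebesgue) / emeasure lebesgue (ball a r)
      \<le> ennreal \<kappa> * N * gen_inv \<Phi> (ennreal (1 / r ^ CARD('n)))"
  shows "\<Psi> (frac_maximal \<rho> f x / (ennreal (A * max C0 \<kappa>) * N)) \<le> \<Phi> (HL_maximal f x / (ennreal C0 * N))"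
proof (rule ccontr)
  define s where "s = HL_maximal f x / (ennreal C0 * N)"
  define D where "D = A * max C0 \<kappa>"
  have D: "D > 0" using A C0 by (simp add: D_def)
  have fin: "ennreal C0 * N \<noteq> 0" "ennreal C0 * N \<noteq> top" "ennreal D * N \<noteq> 0" "ennreal D * N \<noteq> top"
    using C0 D N by (simp_all add: ennreal_mult_eq_top_iff)
  have HL: "HL_maximal f x = s * (ennreal C0 * N)"
    using fin by (simp add: s_def ennreal_divide_times top.not_eq_extremum)
  assume "\<not> ?thesis"
  then have "\<Phi> s < \<Psi> (frac_maximal \<rho> f x / (ennreal D * N))" by (simp add: s_def D_def)
  \<comment> \<open>A value strictly in between is positive and finite even if the left side is 0 or
    the right side infinite. It yields s \<le> \<Phi>^-1 u. It remains to bound the fractional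
    maximal function by \<Psi>^-1 u times D N, since then the value on the right is at most
    u.\<close>
  from dense[OF this] obtain y where y: "\<Phi> s < y" "y < \<Psi> (frac_maximal \<rho> f x / (ennreal D * N))" by blast
  then have "y \<noteq> 0" "y < top" by (auto intro: less_le_trans)
  then obtain u where u: "y = ennreal u" "u > 0" by (cases y) auto
  define R where "R = root CARD('n) (1 / u)"
  have R: "R > 0" "1 / R ^ CARD('n) = u" using u by (simp_all add: R_def)
  have s: "s \<le> gen_inv \<Phi> (ennreal u)"
    using y u gen_inv_less_iff[OF \<Phi>, of "ennreal u" s] by (simp add: not_less[symmetric])
  have "frac_maximal \<rho> f x \<le> gen_inv \<Psi> (ennreal u) * (ennreal D * N)"
    unfolding frac_maximal_def
  proof (rule SUP_least, clarify)
    fix a r assume r: "r > 0" "x \<in> ball a r"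
    define avg_r where "avg_r = (\<integral>\<^sup>+y\<in>ball a r. e2ennreal \<bar>f y\<bar> \<partial>lebesgue) / emeasure lebesgue (ball a r)"
    have "ennreal (\<rho> r) * avg_r \<le> ennreal A * gen_inv \<Psi> (ennreal u) * (ennreal (max C0 \<kappa>) * N)"
    proof (cases "r \<le> R")
      \<comment> \<open>Small balls: the average is at most M f (x), which is s times
        \<open>C0\<close> N. The condition is used at R, where its supremum covers \<rho> r for
        every r \<le> R.\<close>
      case True
      have "avg_r \<le> s * (ennreal C0 * N)"
        using frac_maximal_upper[OF r, of "\<lambda>_. 1" f] HL by (simp add: avg_r_def)
      also have "\<dots> \<le> gen_inv \<Phi> (ennreal u) * (ennreal C0 * N)" by (rule mult_right_mono[OF s]) simp
      finally have "ennreal (\<rho> r) * avg_r \<le> (SUP t\<in>{0<..R}. ennreal (\<rho> t)) * (gen_inv \<Phi> (ennreal u) * (ennreal C0 * N))"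
        using r True by (intro mult_mono SUP_upper) auto
      also have "\<dots> \<le> ennreal A * gen_inv \<Psi> (ennreal u) * (ennreal C0 * N)"
        using cond R unfolding sup_rho_condition_def mult.assoc[symmetric] by (intro mult_right_mono) auto
      also have "\<dots> \<le> ennreal A * gen_inv \<Psi> (ennreal u) * (ennreal (max C0 \<kappa>) * N)"
        by (intro mult_left_mono mult_right_mono ennreal_leI) auto
      finally show ?thesis .
    next
      \<comment> \<open>Large balls: the average is bounded by the norm. The condition is used at r
        itself, and monotonicity of \<Psi>^-1 then replaces 1 / r^n by u. The constants
        \<open>C0\<close> and \<kappa> of the two cases explain the maximum in the
        statement.\<close>
      case False
      have "ennreal (\<rho> r) * avg_r \<le> (SUP t\<in>{0<..r}. ennreal (\<rho> t)) * (gen_inv \<Phi> (ennreal (1 / r ^ CARD('n))) * (ennreal \<kappa> * N))"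
        using r avg[OF r(1), of a] by (intro mult_mono SUP_upper) (auto simp: avg_r_def mult_ac)
      also have "\<dots> \<le> ennreal A * gen_inv \<Psi> (ennreal (1 / r ^ CARD('n))) * (ennreal \<kappa> * N)"
        using cond r(1) unfolding sup_rho_condition_def mult.assoc[symmetric] by (intro mult_right_mono) auto
      also have "\<dots> \<le> ennreal A * gen_inv \<Psi> (ennreal u) * (ennreal (max C0 \<kappa>) * N)"
      proof (intro mult_mono monoD[OF gen_inv_mono] ennreal_leI order_refl)
        have "R ^ CARD('n) \<le> r ^ CARD('n)" using False R by (intro power_mono) auto
        then show "1 / r ^ CARD('n) \<le> u" using R r by (auto simp flip: R(2) intro!: divide_left_mono)
      qed auto
      finally show ?thesis .
    qed
    also have "\<dots> = gen_inv \<Psi> (ennreal u) * (ennreal D * N)"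
      using A by (simp add: D_def ennreal_mult' mult_ac)
    finally show "ennreal (\<rho> r) * ((\<integral>\<^sup>+y\<in>ball a r. e2ennreal \<bar>f y\<bar> \<partial>lebesgue) / emeasure lebesgue (ball a r))
      \<le> gen_inv \<Psi> (ennreal u) * (ennreal D * N)" by (simp add: avg_r_def)
  qed
  then have "frac_maximal \<rho> f x / (ennreal D * N) \<le> gen_inv \<Psi> (ennreal u)"
    using fin by (simp add: divide_le_ennreal_iff)
  then show False using y u gen_inv_less_iff[OF \<Psi>, of "ennreal u"] by (simp add: not_less[symmetric])
qed

text \<open>For v < \<Psi> t the set where h > t lies in the set where g > s, with s = \<Phi>^-1 v.
  The hypothesis at level s itself is too weak, because \<Phi> s can be smaller than v, so s is
  approached from above.\<close>

lemma weak_modular_transfer: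
  fixes g h :: "'a::euclidean_space \<Rightarrow> ennreal"
  assumes \<Phi>: "\<Phi> \<in> Phi_bar" and \<Psi>: "\<Psi> \<in> Phi_bar" and W: "weak_modular_le_1 \<Phi> g"
    and g[measurable]: "g \<in> borel_measurable lebesgue"
    and le: "\<And>x. \<Psi> (h x) \<le> \<Phi> (g x)"
  shows "weak_modular_le_1 \<Psi> h"
  unfolding weak_modular_le_1_def
proof (intro allI impI, rule ennreal_mult_leI_dense)
  fix t v :: real assume t: "t > 0" and v: "0 < v" "ennreal v < \<Psi> (ennreal t)"
  define s where "s = gen_inv \<Phi> (ennreal v)"
  have s: "s < top" using gen_inv_finite[OF \<Phi>, of "ennreal v"] by (simp add: s_def)
  \<comment> \<open>Levels strictly above s, so that \<Phi> exceeds v at each of them; they are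
    positive even for s = 0. As they decrease to s, the level sets of g increase to the set where g
    > s.\<close>
  define d where "d j = enn2real s + 1 / Suc j" for j
  have d: "d j > 0" "s < ennreal (d j)" for j
  proof -
    show "d j > 0" by (simp add: d_def add_nonneg_pos)
    have "s = ennreal (enn2real s)" using s by simp
    also have "\<dots> < ennreal (d j)" by (rule ennreal_lessI) (simp_all add: d_def add_nonneg_pos)
    finally show "s < ennreal (d j)" .
  qed
  have "{x. ennreal t < h x} \<subseteq> (\<Union>j. {x. ennreal (d j) < g x})"
  proof safe
    fix x assume "ennreal t < h x"
    then have "\<Psi> (ennreal t) \<le> \<Phi> (g x)" using le[of x] Phi_bar_le[OF \<Psi>] less_imp_le order_trans by metis
    then have "s < g x" using v gen_inv_less_iff[OF \<Phi>, of "ennreal v" "g x"] by (simp add: s_def)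
    from dense[OF this] obtain y where y: "s < y" "y < g x" by blast
    then have "y < top" by (auto intro: less_le_trans)
    then obtain w where w: "s < ennreal w" "ennreal w < g x" "0 \<le> w" using y by (cases y) auto
    have "ennreal (enn2real s) < ennreal w" using w s by simp
    then have "enn2real s < w" by (simp add: ennreal_less_iff)
    then obtain j where "1 / Suc j < w - enn2real s" using nat_approx_posE[of "w - enn2real s"] by (metis diff_gt_0_iff_gt of_nat_Suc)
    then have "ennreal (d j) < g x" using w by (intro le_less_trans[OF _ w(2)] ennreal_leI) (simp add: d_def)
    then show "x \<in> (\<Union>j. {x. ennreal (d j) < g x})" by blast
  qed
  then have "emeasure lebesgue {x. ennreal t < h x} \<le> emeasure lebesgue (\<Union>j. {x. ennreal (d j) < g x})"
    by (intro emeasure_mono) (auto intro!: sets.countable_UN sets_superlevel)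
  also have "\<dots> = (SUP j. emeasure lebesgue {x. ennreal (d j) < g x})"
  proof (rule SUP_emeasure_incseq[symmetric])
    have "d (Suc j) \<le> d j" for j by (simp add: d_def field_simps)
    then show "incseq (\<lambda>j. {x. ennreal (d j) < g x})"
      by (auto intro!: incseq_SucI intro: le_less_trans ennreal_leI)
  qed (auto intro: sets_superlevel)
  finally have "ennreal v * emeasure lebesgue {x. ennreal t < h x}
    \<le> (SUP j. ennreal v * emeasure lebesgue {x. ennreal (d j) < g x})"
    by (simp add: SUP_mult_left_ennreal[symmetric] mult_left_mono)
  also have "\<dots> \<le> 1"
  proof (rule SUP_least)
    fix j
    have "ennreal v \<le> \<Phi> (ennreal (d j))"
      using d[of j] gen_inv_less_iff[OF \<Phi>, of "ennreal v" "ennreal (d j)"] by (simp add: s_def)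
    then have "ennreal v * emeasure lebesgue {x. ennreal (d j) < g x} \<le> \<Phi> (ennreal (d j)) * emeasure lebesgue {x. ennreal (d j) < g x}"
      by (rule mult_right_mono) simp
    also have "\<dots> \<le> 1" using W d unfolding weak_modular_le_1_def by blast
    finally show "ennreal v * emeasure lebesgue {x. ennreal (d j) < g x} \<le> 1" .
  qed
  finally show "ennreal v * emeasure lebesgue {x. ennreal t < h x} \<le> 1" .
qed

section \<open>Modular estimates for the Hardy--Littlewood operator\<close>

lemma ennreal_divide_mult_cancel:
  assumes "a \<ge> 0" "b > 0" shows "ennreal (a / b) * (ennreal b * x) = ennreal a * x"
  using assms by (simp add: mult.assoc[symmetric] ennreal_mult'[symmetric])

text \<open>On a ball where the average of f / l exceeds 2 \<sigma>, the constant part accounts for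
  only \<sigma>, so the average of G exceeds \<sigma>. The covering estimate then applies to G
  alone.\<close>

lemma HL_maximal_level:
  fixes f :: "'n::finite fn"
  assumes l: "l > 0" and f: "f \<in> borel_measurable lebesgue"
    and G: "G \<in> borel_measurable lebesgue" and \<sigma>: "\<sigma> > 0"
    and le: "\<And>y. e2ennreal \<bar>f y\<bar> / ennreal l \<le> ennreal \<sigma> + G y"
  shows "ennreal \<sigma> * emeasure lebesgue {x. ennreal (2 * \<sigma>) < HL_maximal f x / ennreal l}
    \<le> 5 ^ CARD('n) * (\<integral>\<^sup>+y. G y \<partial>lebesgue)"
proof -
  have "ennreal \<sigma> * emeasure lebesgue {x. ennreal (2 * \<sigma>) < HL_maximal f x / ennreal l}
    \<le> 5 ^ DIM(real ^ 'n) * (\<integral>\<^sup>+y. G y \<partial>lebesgue)"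
  proof (rule weak_type_covering[OF G])
    show "{x. ennreal (2 * \<sigma>) < HL_maximal f x / ennreal l} \<in> sets lebesgue"
      by (intro sets_superlevel borel_measurable_divide_ennreal frac_maximal_measurable) simp
    fix x assume "x \<in> {x. ennreal (2 * \<sigma>) < HL_maximal f x / ennreal l}"
    then obtain a r where ar: "r > 0" "x \<in> ball a r"
      "ennreal (2 * \<sigma>) * emeasure lebesgue (ball a r) < (\<integral>\<^sup>+y\<in>ball a r. (e2ennreal \<bar>f y\<bar> / ennreal l) \<partial>lebesgue)"
      unfolding less_HL_maximal_divide_iff[OF l f] mem_Collect_eq by blast
    have "ennreal \<sigma> * emeasure lebesgue (ball a r) < (\<integral>\<^sup>+y\<in>ball a r. G y \<partial>lebesgue)"
    proof (rule ccontr)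
      assume "\<not> ?thesis"
      then have "ennreal \<sigma> * emeasure lebesgue (ball a r) + (\<integral>\<^sup>+y\<in>ball a r. G y \<partial>lebesgue)
        \<le> ennreal \<sigma> * emeasure lebesgue (ball a r) + ennreal \<sigma> * emeasure lebesgue (ball a r)"
        by (intro add_left_mono) (simp only: not_less)
      also have "\<dots> = ennreal (2 * \<sigma>) * emeasure lebesgue (ball a r)"
        using \<sigma> by (simp only: distrib_right[symmetric] ennreal_plus[symmetric] mult_2 less_imp_le)
      finally show False
        using ar(3) ball_integral_le_split[of G "\<lambda>y. e2ennreal \<bar>f y\<bar> / ennreal l" "ennreal \<sigma>" a r, OF G le] by simp
    qed
    then show "\<exists>a r. r > 0 \<and> x \<in> ball a r \<and> ennreal \<sigma> * emeasure lebesgue (ball a r) < (\<integral>\<^sup>+y\<in>ball a r. G y \<partial>lebesgue)"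
      using ar by blast
  qed
  then show ?thesis by simp
qed

text \<open>Splitting at T = q t with \<sigma> = \<kappa> q t makes \<sigma> cancel against the
  bound \<kappa> T / v for the integral of G. What remains is v |E| \<le> 5^n for all v < \<Phi> (q
  t), and \<open>scale\<close> absorbs the 5^n. The 2 in the denominator is that of
  \<open>HL_maximal_level\<close>.\<close>

lemma weak_modular_HL_maximal:
  fixes f :: "'n::finite fn"
  assumes l: "l > 0" and f: "f \<in> borel_measurable lebesgue" and \<kappa>: "\<kappa> > 0" and q: "q > 0"
    and split: "splits_at_levels \<Phi> \<kappa> (\<lambda>y. e2ennreal \<bar>f y\<bar> / ennreal l)"
    and scale: "\<And>t. 5 ^ CARD('n) * \<Phi> t \<le> \<Phi> (ennreal q * t)"
  shows "weak_modular_le_1 \<Phi> (\<lambda>x. HL_maximal f x / ennreal (2 * \<kappa> * q * l))"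
  unfolding weak_modular_le_1_def
proof (intro allI impI)
  fix t :: real assume t: "t > 0"
  define E where "E = {x. ennreal (2 * (\<kappa> * (q * t))) < HL_maximal f x / ennreal l}"
  have E: "{x. ennreal t < HL_maximal f x / ennreal (2 * \<kappa> * q * l)} = E"
    using l \<kappa> q t by (simp add: E_def less_divide_ennreal_iff ennreal_mult'[symmetric] mult_ac)
  have upper: "\<Phi> (ennreal (q * t)) * emeasure lebesgue E \<le> 5 ^ CARD('n)"
  proof (rule ennreal_mult_leI_dense)
    fix v :: real assume v: "v > 0" "ennreal v < \<Phi> (ennreal (q * t))"
    have s: "q * t > 0" using q t by simp
    obtain G where G: "G \<in> borel_measurable lebesgue" "\<And>y. e2ennreal \<bar>f y\<bar> / ennreal l \<le> ennreal (\<kappa> * (q * t)) + G y"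
      "(\<integral>\<^sup>+y. G y \<partial>lebesgue) \<le> ennreal (\<kappa> * (q * t) / v)"
      using splits_at_levelsE[OF split s v(1) less_imp_le[OF v(2)]] by blast
    have "ennreal (\<kappa> * (q * t)) * emeasure lebesgue E \<le> 5 ^ CARD('n) * (\<integral>\<^sup>+y. G y \<partial>lebesgue)"
      unfolding E_def using \<kappa> s by (intro HL_maximal_level[OF l f G(1) _ G(2)]) simp
    also have "\<dots> \<le> 5 ^ CARD('n) * ennreal (\<kappa> * (q * t) / v)"
      by (rule mult_left_mono[OF G(3)]) simp
    finally have "ennreal (v / (\<kappa> * (q * t))) * (ennreal (\<kappa> * (q * t)) * emeasure lebesgue E)
      \<le> ennreal (v / (\<kappa> * (q * t))) * (5 ^ CARD('n) * ennreal (\<kappa> * (q * t) / v))"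
      by (rule mult_left_mono) simp
    moreover have "ennreal (v / (\<kappa> * (q * t))) * (ennreal (\<kappa> * (q * t)) * emeasure lebesgue E) = ennreal v * emeasure lebesgue E"
      using \<kappa> s v by (intro ennreal_divide_mult_cancel) auto
    moreover have "ennreal (v / (\<kappa> * (q * t))) * (5 ^ CARD('n) * ennreal (\<kappa> * (q * t) / v)) = 5 ^ CARD('n)"
      using \<kappa> q t v by (simp add: mult.left_commute ennreal_mult'[symmetric])
    ultimately show "ennreal v * emeasure lebesgue E \<le> 5 ^ CARD('n)" by simp
  qed
  have "5 ^ CARD('n) * (\<Phi> (ennreal t) * emeasure lebesgue E) \<le> \<Phi> (ennreal (q * t)) * emeasure lebesgue E"
    using scale[of "ennreal t"] q by (simp add: mult.assoc[symmetric] mult_right_mono ennreal_mult')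
  from order_trans[OF this upper]
  have "5 ^ CARD('n) * (\<Phi> (ennreal t) * emeasure lebesgue E) \<le> 5 ^ CARD('n) * 1" by simp
  moreover have "(5::ennreal) ^ CARD('n) \<noteq> 0" "(5::ennreal) ^ CARD('n) \<noteq> top"
    by (simp_all add: power_eq_top_ennreal)
  ultimately show "\<Phi> (ennreal t) * emeasure lebesgue {x. ennreal t < HL_maximal f x / ennreal (2 * \<kappa> * q * l)} \<le> 1"
    unfolding E by (simp only: ennreal_mult_le_mult_iff not_False_eq_True)
qed

section \<open>Discrete interpolation over the powers of k\<close>

lemma power_int_bracket:
  fixes k s :: real assumes k: "k > 1" and s: "s > 0"
  obtains j :: int where "k powi j < s" "s \<le> k powi (j + 1)"
proof (rule that)
  \<comment> \<open>One below the ceiling makes the lower inequality strict, as the strict level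
    sets require.\<close>
  define j where "j = \<lceil>log k s\<rceil> - 1"
  have "k powi j = k powr j" using k by (simp add: powr_real_of_int')
  also have "\<dots> < k powr (log k s)" using k by (intro powr_less_mono) (auto simp: j_def, linarith)
  also have "\<dots> = s" using k s by simp
  finally show "k powi j < s" .
  have "s = k powr (log k s)" using k s by simp
  also have "\<dots> \<le> k powr (j + 1)" using k by (intro powr_mono) (auto simp: j_def)
  also have "\<dots> = k powi (j + 1)" using k powr_real_of_int'[of k "j + 1"] by simp
  finally show "s \<le> k powi (j + 1)" .
qed

text \<open>The integers up to J are enumerated downwards from J, the direction in which the terms
  decay geometrically.\<close>

lemma nn_integral_int_atMost:
  "(\<integral>\<^sup>+j. f j * indicator {..J} j \<partial>count_space UNIV) = (\<Sum>i. f (J - int i) :: ennreal)"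
proof -
  have "(\<integral>\<^sup>+j. f j * indicator {..J} j \<partial>count_space UNIV) = (\<integral>\<^sup>+j. f j \<partial>count_space {..J})"
    by (simp add: nn_integral_count_space_indicator)
  also have "\<dots> = (\<integral>\<^sup>+i. f (J - int i) \<partial>count_space UNIV)"
  proof (rule nn_integral_bij_count_space[symmetric])
    show "bij_betw (\<lambda>i. J - int i) UNIV {..J}"
      by (rule bij_betwI[where g = "\<lambda>j. nat (J - j)"]) auto
  qed
  finally show ?thesis by (simp add: nn_integral_count_space_nat)
qed

text \<open>A discrete substitute for the layer cake formula. For finite positive h the one term
  whose powers of k bracket h already dominates. For infinite h every term occurs, and the
  unboundedness of \<Phi> makes the sum infinite.\<close>

lemma geometric_majorant:
  assumes \<Phi>: "\<Phi> \<in> Phi_bar" and k: "k > 1" and c: "c > 0"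
  shows "\<Phi> (h / ennreal c) \<le> (\<integral>\<^sup>+j. \<Phi> (ennreal (k powi (j + 1) / c)) * indicator {ennreal (k powi j)<..} h \<partial>count_space UNIV)"
    (is "_ \<le> ?S")
proof -
  have pt: "\<Phi> (ennreal (k powi (j + 1) / c)) \<le> ?S" if "ennreal (k powi j) < h" for j
    using nn_integral_ge_point[of j UNIV "\<lambda>j. \<Phi> (ennreal (k powi (j + 1) / c)) * indicator {ennreal (k powi j)<..} h"] that
    by simp
  consider "h = 0" | "h = top" | s where "h = ennreal s" "s > 0" by (cases h) (auto simp: less_le)
  then show ?thesis
  proof cases
    case 1 then show ?thesis by (simp add: Phi_bar_zero[OF \<Phi>])
  next
    case 2
    have "?S = top"
    proof (rule ccontr)
      assume "?S \<noteq> top"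
      then obtain t where t: "t > 0" "?S < \<Phi> (ennreal t)" using Phi_bar_unbounded[OF \<Phi>, of ?S] by (auto simp: less_top)
      obtain j where "t * c \<le> k powi (j + 1)" using power_int_bracket[OF k, of "t * c"] t c by auto
      then have "\<Phi> (ennreal t) \<le> \<Phi> (ennreal (k powi (j + 1) / c))"
        using c by (intro Phi_bar_le[OF \<Phi>] ennreal_leI) (simp add: field_simps)
      then show False using pt[of j] 2 t by auto
    qed
    then show ?thesis by simp
  next
    case 3
    obtain j where j: "k powi j < s" "s \<le> k powi (j + 1)" using power_int_bracket[OF k 3(2)] .
    have "h / ennreal c \<le> ennreal (k powi (j + 1) / c)"
      using 3 c j by (simp add: divide_ennreal divide_right_mono ennreal_leI)
    then have "\<Phi> (h / ennreal c) \<le> \<Phi> (ennreal (k powi (j + 1) / c))" by (rule Phi_bar_le[OF \<Phi>])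
    also have "\<dots> \<le> ?S" using j 3 k by (intro pt) (simp add: ennreal_less_iff)
    finally show ?thesis .
  qed
qed

text \<open>What is left at a single point after sum and integral are exchanged. Only j \<le> J
  contribute, where k^J < 2 g \<le> k^(J+1). Going down i steps from J multiplies 2 g / k^j by k^i
  and divides the bound for \<Phi> by (2k)^i, so the term is at most k 2^-i \<Phi> (2 k g / c); the
  total is 2 k.\<close>

lemma geometric_sum_bound:
  assumes \<Phi>: "\<Phi> \<in> Phi_bar" and k: "k > 1" "\<And>j t. ennreal ((2 * k) ^ j) * \<Phi> t \<le> \<Phi> (ennreal (k ^ j) * t)" and c: "c > 0"
  shows "(\<integral>\<^sup>+j. ennreal (2 / k powi j) * \<Phi> (ennreal (k powi (j + 1) / c)) * (g * indicator {ennreal (k powi j / 2)<..} g) \<partial>count_space UNIV)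
    \<le> ennreal (2 * k) * \<Phi> (ennreal (2 * k / c) * g)" (is "?S \<le> _")
proof -
  consider "g = 0" | "g = top" | s where "g = ennreal s" "s > 0" by (cases g) (auto simp: less_le)
  then show ?thesis
  proof cases
    case 2 then show ?thesis using k c by (simp add: Phi_bar_top[OF \<Phi>] ennreal_mult_top)
  next
    case 3
    obtain J where J: "k powi J < 2 * s" "2 * s \<le> k powi (J + 1)" using power_int_bracket[OF k(1), of "2 * s"] 3 by auto
    define P where "P = \<Phi> (ennreal (2 * k / c) * g)"
    have "?S \<le> (\<integral>\<^sup>+j. ennreal (2 / k powi j) * \<Phi> (ennreal (k powi (j + 1) / c)) * g * indicator {..J} j \<partial>count_space UNIV)"
    proof (intro nn_integral_mono)
      fix j
      have "j \<le> J" if "ennreal (k powi j / 2) < g"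
      proof (rule ccontr)
        assume "\<not> j \<le> J"
        then have "k powi (J + 1) \<le> k powi j" using k by (intro power_int_increasing) auto
        then show False using that 3 J k by (simp add: ennreal_less_iff)
      qed
      then show "ennreal (2 / k powi j) * \<Phi> (ennreal (k powi (j + 1) / c)) * (g * indicator {ennreal (k powi j / 2)<..} g)
        \<le> ennreal (2 / k powi j) * \<Phi> (ennreal (k powi (j + 1) / c)) * g * indicator {..J} j"
        by (auto simp: indicator_def mult.assoc)
    qed
    also have "\<dots> = (\<Sum>i. ennreal (2 / k powi (J - int i)) * \<Phi> (ennreal (k powi (J - int i + 1) / c)) * g)"
      by (rule nn_integral_int_atMost)
    also have "\<dots> \<le> (\<Sum>i. ennreal (k * (1 / 2) ^ i) * P)"
    proof (rule suminf_le)
      fix i :: nat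
      have kp: "k powi (J - int i) = k powi J / k ^ i" "k powi (J - int i + 1) = k powi (J + 1) / k ^ i"
        "k powi (J + 1) = k * k powi J" "k powi J > 0"
        using k power_int_diff[of k J "int i"] power_int_diff[of k "J + 1" "int i"]
        by (auto simp: power_int_add algebra_simps)
      have "ennreal ((2 * k) ^ i) * \<Phi> (ennreal (k powi (J - int i + 1) / c))
        \<le> \<Phi> (ennreal (k ^ i) * ennreal (k powi (J - int i + 1) / c))" by (rule k(2))
      also have "ennreal (k ^ i) * ennreal (k powi (J - int i + 1) / c) = ennreal (k powi (J + 1) / c)"
        using k c kp by (simp add: ennreal_mult'[symmetric])
      also have "\<Phi> (ennreal (k powi (J + 1) / c)) \<le> P"
        unfolding P_def using J k c 3 kp by (intro Phi_bar_le[OF \<Phi>]) (simp add: ennreal_mult'[symmetric] ennreal_leI divide_right_mono)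
      finally have *: "ennreal ((2 * k) ^ i) * \<Phi> (ennreal (k powi (J - int i + 1) / c)) \<le> P" .
      have "ennreal (2 / k powi (J - int i)) * \<Phi> (ennreal (k powi (J - int i + 1) / c)) * g
        = ennreal (2 * s / k powi (J - int i) / (2 * k) ^ i) * (ennreal ((2 * k) ^ i) * \<Phi> (ennreal (k powi (J - int i + 1) / c)))"
      proof -
        let ?X = "\<Phi> (ennreal (k powi (J - int i + 1) / c))"
        have eq: "ennreal (2 / k powi (J - int i)) * g = ennreal (2 * s / k powi (J - int i) / (2 * k) ^ i) * ennreal ((2 * k) ^ i)"
          using 3 k by (simp add: ennreal_mult''[symmetric])
        have "ennreal (2 / k powi (J - int i)) * ?X * g = ennreal (2 / k powi (J - int i)) * g * ?X"
          by (simp only: mult_ac)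
        then show ?thesis unfolding eq by (simp only: mult.assoc)
      qed
      also have "\<dots> \<le> ennreal (k * (1 / 2) ^ i) * P"
      proof (intro mult_mono * ennreal_leI)
        have "2 * s / k powi (J - int i) / (2 * k) ^ i \<le> (k * k powi J) / k powi (J - int i) / (2 * k) ^ i"
          using J kp k by (intro divide_right_mono) auto
        also have "\<dots> = k * (1 / 2) ^ i"
          using k kp by (simp add: field_simps power_mult_distrib)
        finally show "2 * s / k powi (J - int i) / (2 * k) ^ i \<le> k * (1 / 2) ^ i" .
      qed auto
      finally show "ennreal (2 / k powi (J - int i)) * \<Phi> (ennreal (k powi (J - int i + 1) / c)) * g \<le> ennreal (k * (1 / 2) ^ i) * P" .
    qed auto
    also have "\<dots> = (\<Sum>i. ennreal (k * (1 / 2) ^ i)) * P" by simp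
    also have "(\<Sum>i. ennreal (k * (1 / 2) ^ i)) = ennreal (2 * k)"
    proof (rule suminf_ennreal_eq)
      show "(\<lambda>i. k * (1 / 2) ^ i) sums (2 * k)"
        using sums_mult[OF geometric_sums[of "1/2::real"], of k] by (simp add: mult_ac)
    qed (use k in auto)
    finally show ?thesis by (simp add: P_def)
  qed simp
qed

text \<open>At level k^j only the part of f / l above k^j / 2 matters, by
  \<open>HL_maximal_level\<close> with \<sigma> = k^j / 2. Summing over j and exchanging the order
  gives 5^n times 2 k times a modular of f.\<close>

lemma modular_HL_maximal:
  fixes f :: "'n::finite fn"
  assumes \<Phi>: "\<Phi> \<in> Phi_bar" and l: "l > 0" and f[measurable]: "f \<in> borel_measurable lebesgue"
    and k: "k > 1" "\<And>j t. ennreal ((2 * k) ^ j) * \<Phi> t \<le> \<Phi> (ennreal (k ^ j) * t)"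
    and m: "2 * k * 5 ^ CARD('n) \<le> (2 * k) ^ m"
    and mod: "(\<integral>\<^sup>+y. \<Phi> (e2ennreal \<bar>f y\<bar> / ennreal l) \<partial>lebesgue) \<le> 1"
  shows "(\<integral>\<^sup>+x. \<Phi> (HL_maximal f x / ennreal (2 * k * k ^ m * l)) \<partial>lebesgue) \<le> 1"
proof -
  define g where "g y = e2ennreal \<bar>f y\<bar> / ennreal l" for y
  define h where "h x = HL_maximal f x / ennreal l" for x
  \<comment> \<open>Then 2 k / c = k^-m, and m iterations of the nabla-2 inequality pay for the
    factor 2 k 5^n collected below.\<close>
  define c where "c = 2 * k * k ^ m"
  have c: "c > 0" using k by (simp add: c_def)
  have [measurable]: "g \<in> borel_measurable lebesgue" unfolding g_def by measurable
  have h[measurable]: "h \<in> borel_measurable lebesgue"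
    unfolding h_def by (intro borel_measurable_divide_ennreal frac_maximal_measurable) simp
  have [measurable]: "\<Phi> \<in> borel_measurable borel" by (rule Phi_bar_measurable[OF \<Phi>])
  define \<phi> where "\<phi> j = \<Phi> (ennreal (k powi (j + 1) / c))" for j
  define G where "G j y = g y * indicator {ennreal (k powi j / 2)<..} (g y)" for j y
  have G[measurable]: "G j \<in> borel_measurable lebesgue" for j unfolding G_def by measurable
  have level: "emeasure lebesgue {x. ennreal (k powi j) < h x} \<le> ennreal (2 / k powi j) * (5 ^ CARD('n) * (\<integral>\<^sup>+y. G j y \<partial>lebesgue))" for j
  proof -
    have kj: "k powi j > 0" using k by simp
    have "ennreal (k powi j / 2) * emeasure lebesgue {x. ennreal (2 * (k powi j / 2)) < HL_maximal f x / ennreal l} \<le> 5 ^ CARD('n) * (\<integral>\<^sup>+y. G j y \<partial>lebesgue)"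
    proof (rule HL_maximal_level[OF l f G])
      fix y show "e2ennreal \<bar>f y\<bar> / ennreal l \<le> ennreal (k powi j / 2) + G j y"
        by (auto simp: G_def g_def[symmetric] indicator_def add_increasing)
    qed (use kj in simp)
    then have "ennreal (1 / (k powi j / 2)) * (ennreal (k powi j / 2) * emeasure lebesgue {x. ennreal (k powi j) < h x}) \<le> ennreal (1 / (k powi j / 2)) * (5 ^ CARD('n) * (\<integral>\<^sup>+y. G j y \<partial>lebesgue))"
      by (intro mult_left_mono) (simp_all add: h_def)
    then show ?thesis using kj ennreal_divide_mult_cancel[of 1 "k powi j / 2"] by simp
  qed
  have "(\<integral>\<^sup>+x. \<Phi> (HL_maximal f x / ennreal (c * l)) \<partial>lebesgue) = (\<integral>\<^sup>+x. \<Phi> (h x / ennreal c) \<partial>lebesgue)"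
    using c l by (simp add: h_def ennreal_mult divide_ennreal_def ennreal_inverse_mult mult_ac)
  also have "\<dots> \<le> (\<integral>\<^sup>+x. (\<integral>\<^sup>+j. \<phi> j * indicator {x. ennreal (k powi j) < h x} x \<partial>count_space UNIV) \<partial>lebesgue)"
    using geometric_majorant[OF \<Phi> k(1) c] by (intro nn_integral_mono) (simp add: \<phi>_def indicator_def)
  also have "\<dots> = (\<integral>\<^sup>+j. \<phi> j * emeasure lebesgue {x. ennreal (k powi j) < h x} \<partial>count_space UNIV)"
  proof (subst nn_integral_count_space_nn_integral)
    have [measurable]: "{x. ennreal (k powi j) < h x} \<in> sets lebesgue" for j by (rule sets_superlevel[OF h])
    show "(\<integral>\<^sup>+j. (\<integral>\<^sup>+x. \<phi> j * indicator {x. ennreal (k powi j) < h x} x \<partial>lebesgue) \<partial>count_space UNIV) =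
      (\<integral>\<^sup>+j. \<phi> j * emeasure lebesgue {x. ennreal (k powi j) < h x} \<partial>count_space UNIV)"
      by (simp add: nn_integral_cmult_indicator)
    show "(\<lambda>x. \<phi> j * indicator {x. ennreal (k powi j) < h x} x) \<in> borel_measurable lebesgue" for j by measurable
  qed auto
  also have "\<dots> \<le> (\<integral>\<^sup>+j. \<phi> j * (ennreal (2 / k powi j) * (5 ^ CARD('n) * (\<integral>\<^sup>+y. G j y \<partial>lebesgue))) \<partial>count_space UNIV)"
    by (intro nn_integral_mono mult_left_mono level) simp
  also have "\<dots> = (\<integral>\<^sup>+j. 5 ^ CARD('n) * (ennreal (2 / k powi j) * \<phi> j * (\<integral>\<^sup>+y. G j y \<partial>lebesgue)) \<partial>count_space UNIV)"
    by (simp only: mult_ac)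
  also have "\<dots> = 5 ^ CARD('n) * (\<integral>\<^sup>+j. ennreal (2 / k powi j) * \<phi> j * (\<integral>\<^sup>+y. G j y \<partial>lebesgue) \<partial>count_space UNIV)"
    by (rule nn_integral_cmult) simp
  also have "(\<integral>\<^sup>+j. ennreal (2 / k powi j) * \<phi> j * (\<integral>\<^sup>+y. G j y \<partial>lebesgue) \<partial>count_space UNIV)
    = (\<integral>\<^sup>+j. (\<integral>\<^sup>+y. ennreal (2 / k powi j) * \<phi> j * G j y \<partial>lebesgue) \<partial>count_space UNIV)"
    by (subst nn_integral_cmult) simp_all
  also have "\<dots> = (\<integral>\<^sup>+y. (\<integral>\<^sup>+j. ennreal (2 / k powi j) * \<phi> j * G j y \<partial>count_space UNIV) \<partial>lebesgue)"
    by (subst nn_integral_count_space_nn_integral) auto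
  also have "\<dots> \<le> (\<integral>\<^sup>+y. ennreal (2 * k) * \<Phi> (ennreal (2 * k / c) * g y) \<partial>lebesgue)"
    using geometric_sum_bound[OF \<Phi> k c] by (intro nn_integral_mono) (simp add: \<phi>_def G_def)
  also have "\<dots> = ennreal (2 * k) * (\<integral>\<^sup>+y. \<Phi> (ennreal (2 * k / c) * g y) \<partial>lebesgue)"
    by (subst nn_integral_cmult) simp_all
  finally have "(\<integral>\<^sup>+x. \<Phi> (HL_maximal f x / ennreal (c * l)) \<partial>lebesgue)
     \<le> 5 ^ CARD('n) * (ennreal (2 * k) * (\<integral>\<^sup>+y. \<Phi> (ennreal (2 * k / c) * g y) \<partial>lebesgue))"
    by (simp add: mult_left_mono)
  also have "\<dots> = ennreal (2 * k * 5 ^ CARD('n)) * (\<integral>\<^sup>+y. \<Phi> (ennreal (2 * k / c) * g y) \<partial>lebesgue)"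
    using k by (simp add: ennreal_mult ennreal_power[symmetric] mult_ac)
  also have "\<dots> \<le> ennreal ((2 * k) ^ m) * (\<integral>\<^sup>+y. \<Phi> (ennreal (2 * k / c) * g y) \<partial>lebesgue)"
    using m by (intro mult_right_mono ennreal_leI) auto
  also have "\<dots> = (\<integral>\<^sup>+y. ennreal ((2 * k) ^ m) * \<Phi> (ennreal (2 * k / c) * g y) \<partial>lebesgue)"
    by (subst nn_integral_cmult) simp_all
  also have "\<dots> \<le> (\<integral>\<^sup>+y. \<Phi> (g y) \<partial>lebesgue)"
  proof (rule nn_integral_mono)
    fix y
    have "ennreal (k ^ m) * (ennreal (2 * k / c) * g y) = g y"
      using k by (simp add: c_def mult.assoc[symmetric] ennreal_mult'[symmetric])
    then show "ennreal ((2 * k) ^ m) * \<Phi> (ennreal (2 * k / c) * g y) \<le> \<Phi> (g y)"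
      using k(2)[of m "ennreal (2 * k / c) * g y"] by simp
  qed
  also have "\<dots> \<le> 1" using mod by (simp add: g_def)
  finally show ?thesis by (simp add: c_def)
qed

section \<open>Norm estimates\<close>

lemma gen_inv_real:
  assumes "\<Phi> \<in> Phi_bar" "u > 0"
  obtains s where "gen_inv \<Phi> (ennreal u) = ennreal s" "s > 0"
  using gen_inv_pos[OF assms(1), of "ennreal u"] gen_inv_finite[OF assms(1), of "ennreal u"] assms(2)
  by (cases "gen_inv \<Phi> (ennreal u)") auto

lemma le_ennreal_all_eq_0:
  assumes "\<And>l::real. l > 0 \<Longrightarrow> x \<le> ennreal l" shows "x = 0"
proof (rule ccontr)
  assume "x \<noteq> 0"
  then have "0 < x" by (simp add: zero_less_iff_neq_zero)
  from dense[OF this] obtain y where y: "0 < y" "y < x" by blast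
  then have "y < top" by (auto intro: less_le_trans)
  then obtain l where "y = ennreal l" "l > 0" using y by (cases y) auto
  then show False using assms[of l] y by simp
qed

lemma orlicz_norm_eq:
  "orlicz_norm \<Phi> f = (INF l\<in>{l. l > 0 \<and> (\<integral>\<^sup>+x. \<Phi> (e2ennreal \<bar>f x\<bar> / ennreal l) \<partial>lebesgue) \<le> 1}. ennreal l)"
  unfolding orlicz_norm_def by (intro INF_cong refl) (auto simp: e2ennreal_abs_divide)

lemma less_ereal_divide_iff:
  assumes "l > 0" "t \<ge> 0"
  shows "ereal t < \<bar>y / ereal l\<bar> \<longleftrightarrow> ennreal t < e2ennreal \<bar>y\<bar> / ennreal l"
  using assms by (cases y) (simp_all add: divide_ennreal ennreal_less_iff ennreal_top_divide)

lemma weak_orlicz_norm_eq: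
  "weak_orlicz_norm \<Phi> f = (INF l\<in>{l. l > 0 \<and> weak_modular_le_1 \<Phi> (\<lambda>x. e2ennreal \<bar>f x\<bar> / ennreal l)}. ennreal l)"
proof -
  have "(SUP t\<in>{0<..}. \<Phi> (ennreal t) * distr_fun (\<lambda>x. f x / ereal l) t) \<le> 1 \<longleftrightarrow>
    weak_modular_le_1 \<Phi> (\<lambda>x. e2ennreal \<bar>f x\<bar> / ennreal l)" if l: "l > 0" for l
  proof -
    have "distr_fun (\<lambda>x. f x / ereal l) t = emeasure lebesgue {x. ennreal t < e2ennreal \<bar>f x\<bar> / ennreal l}" if "t > 0" for t
      unfolding distr_fun_def by (simp only: less_ereal_divide_iff[OF l less_imp_le[OF that]])
    then show ?thesis by (auto simp: SUP_le_iff weak_modular_le_1_def)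
  qed
  then have "{l. l > 0 \<and> (SUP t\<in>{0<..}. \<Phi> (ennreal t) * distr_fun (\<lambda>x. f x / ereal l) t) \<le> 1} =
    {l. l > 0 \<and> weak_modular_le_1 \<Phi> (\<lambda>x. e2ennreal \<bar>f x\<bar> / ennreal l)}" by blast
  then show ?thesis unfolding weak_orlicz_norm_def by (rule arg_cong)
qed

lemma ennreal_divide_antimono:
  assumes "0 < l" "l \<le> l'" shows "x / ennreal l' \<le> x / ennreal l"
  using assms by (cases x) (auto simp: divide_ennreal ennreal_top_divide intro!: ennreal_leI divide_left_mono)

text \<open>Staying strictly above the norm avoids showing that the infimum is attained. This is why
  the estimates below work at 2 \<nu> when the norm is \<nu>.\<close>

lemma modular_above_orlicz_norm:
  assumes \<Phi>: "\<Phi> \<in> Phi_bar" and lt: "orlicz_norm \<Phi> f < ennreal l"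
  shows "(\<integral>\<^sup>+x. \<Phi> (e2ennreal \<bar>f x\<bar> / ennreal l) \<partial>lebesgue) \<le> 1"
proof -
  obtain l' where l': "l' > 0" "(\<integral>\<^sup>+x. \<Phi> (e2ennreal \<bar>f x\<bar> / ennreal l') \<partial>lebesgue) \<le> 1" "l' < l"
    using lt unfolding orlicz_norm_eq INF_less_iff by (auto simp: ennreal_less_iff)
  have "(\<integral>\<^sup>+x. \<Phi> (e2ennreal \<bar>f x\<bar> / ennreal l) \<partial>lebesgue) \<le> (\<integral>\<^sup>+x. \<Phi> (e2ennreal \<bar>f x\<bar> / ennreal l') \<partial>lebesgue)"
    using l' by (intro nn_integral_mono Phi_bar_le[OF \<Phi>] ennreal_divide_antimono) auto
  then show ?thesis using l'(2) by (rule order_trans)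
qed

lemma weak_modular_above_weak_orlicz_norm:
  fixes f :: "'n::finite fn"
  assumes f[measurable]: "f \<in> borel_measurable lebesgue" and lt: "weak_orlicz_norm \<Phi> f < ennreal l"
  shows "weak_modular_le_1 \<Phi> (\<lambda>x. e2ennreal \<bar>f x\<bar> / ennreal l)"
proof -
  obtain l' where l': "l' > 0" "weak_modular_le_1 \<Phi> (\<lambda>x. e2ennreal \<bar>f x\<bar> / ennreal l')" "l' < l"
    using lt unfolding weak_orlicz_norm_eq INF_less_iff by (auto simp: ennreal_less_iff)
  show ?thesis unfolding weak_modular_le_1_def
  proof (intro allI impI)
    fix t :: real assume t: "t > 0"
    have "\<Phi> (ennreal t) * emeasure lebesgue {x. ennreal t < e2ennreal \<bar>f x\<bar> / ennreal l}
      \<le> \<Phi> (ennreal t) * emeasure lebesgue {x. ennreal t < e2ennreal \<bar>f x\<bar> / ennreal l'}"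
    proof (intro mult_left_mono emeasure_mono)
      show "{x. ennreal t < e2ennreal \<bar>f x\<bar> / ennreal l} \<subseteq> {x. ennreal t < e2ennreal \<bar>f x\<bar> / ennreal l'}"
        using ennreal_divide_antimono[of l' l] l' by (auto intro: less_le_trans)
      show "{x. ennreal t < e2ennreal \<bar>f x\<bar> / ennreal l'} \<in> sets lebesgue"
        by (rule sets_superlevel) measurable
    qed simp
    also have "\<dots> \<le> 1" using l'(2) t unfolding weak_modular_le_1_def by blast
    finally show "\<Phi> (ennreal t) * emeasure lebesgue {x. ennreal t < e2ennreal \<bar>f x\<bar> / ennreal l} \<le> 1" .
  qed
qed

text \<open>The information about N that the pointwise inequality uses, with \<kappa> uniform in f.
  It lets the strong and the weak norm share one argument.\<close>

definition averages_bounded :: "real \<Rightarrow> (ennreal \<Rightarrow> ennreal) \<Rightarrow> ('n::finite fn \<Rightarrow> ennreal) \<Rightarrow> bool" where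
  "averages_bounded \<kappa> \<Phi> N \<longleftrightarrow> (\<forall>f \<in> fn_space N. \<forall>a. \<forall>r > 0.
     (\<integral>\<^sup>+y\<in>ball a r. e2ennreal \<bar>f y\<bar> \<partial>lebesgue) / emeasure lebesgue (ball a r)
       \<le> ennreal \<kappa> * N f * gen_inv \<Phi> (ennreal (1 / r ^ CARD('n))))"

lemma averages_boundedI:
  fixes N :: "'n::finite fn \<Rightarrow> ennreal"
  assumes "\<And>f a r. f \<in> fn_space N \<Longrightarrow> r > 0 \<Longrightarrow>
    (\<integral>\<^sup>+y\<in>ball a r. e2ennreal \<bar>f y\<bar> \<partial>lebesgue) / emeasure lebesgue (ball a r)
      \<le> ennreal \<kappa> * N f * gen_inv \<Phi> (ennreal (1 / r ^ CARD('n)))"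
  shows "averages_bounded \<kappa> \<Phi> N"
  using assms by (simp add: averages_bounded_def del: emeasure_completion)

lemma averages_boundedD:
  fixes N :: "'n::finite fn \<Rightarrow> ennreal"
  assumes "averages_bounded \<kappa> \<Phi> N" "f \<in> fn_space N" "r > 0"
  shows "(\<integral>\<^sup>+y\<in>ball a r. e2ennreal \<bar>f y\<bar> \<partial>lebesgue) / emeasure lebesgue (ball a r)
      \<le> ennreal \<kappa> * N f * gen_inv \<Phi> (ennreal (1 / r ^ CARD('n)))"
  using assms by (simp add: averages_bounded_def del: emeasure_completion)

text \<open>For each admissible l the average of f / l is already controlled; multiply by l and take
  the infimum. The inverse is positive and finite, as \<open>le_mult_INF_ennreal\<close>
  requires.\<close>

lemma average_le_norm:
  fixes f :: "'n::finite fn"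
  assumes \<Phi>: "\<Phi> \<in> Phi_bar" and \<kappa>: "\<kappa> > 0" and f[measurable]: "f \<in> borel_measurable lebesgue"
    and r: "r > 0"
    and S: "\<And>l. l \<in> S \<Longrightarrow> l > 0" "\<And>l. l \<in> S \<Longrightarrow> splits_at_levels \<Phi> \<kappa> (\<lambda>y. e2ennreal \<bar>f y\<bar> / ennreal l)"
  shows "(\<integral>\<^sup>+y\<in>ball a r. e2ennreal \<bar>f y\<bar> \<partial>lebesgue) / emeasure lebesgue (ball a r)
    \<le> ennreal (\<kappa> * (1 + 1 / unit_ball_vol (real CARD('n)))) * (INF l\<in>S. ennreal l) * gen_inv \<Phi> (ennreal (1 / r ^ CARD('n)))"
    (is "?avg \<le> ennreal ?\<kappa>' * _ * ?gi")
proof -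
  have [measurable]: "ball a r \<in> sets lebesgue" by simp
  have "1 / r ^ CARD('n) > 0" using r by simp
  then obtain s where s: "?gi = ennreal s" "s > 0" by (rule gen_inv_real[OF \<Phi>])
  have \<kappa>': "?\<kappa>' > 0" using \<kappa> by (simp add: add_pos_nonneg)
  have "?avg \<le> (ennreal ?\<kappa>' * ?gi) * (INF l\<in>S. ennreal l)"
  proof (rule le_mult_INF_ennreal)
    fix l assume l: "l \<in> S"
    have l': "ennreal l \<noteq> 0" "ennreal l \<noteq> top" using S(1)[OF l] by simp_all
    have "(\<integral>\<^sup>+y\<in>ball a r. (e2ennreal \<bar>f y\<bar> / ennreal l) \<partial>lebesgue)
      = (\<integral>\<^sup>+y. e2ennreal \<bar>f y\<bar> * indicator (ball a r) y / ennreal l \<partial>lebesgue)"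
      by (simp add: ennreal_divide_times ennreal_times_divide mult.commute)
    also have "\<dots> = (\<integral>\<^sup>+y\<in>ball a r. e2ennreal \<bar>f y\<bar> \<partial>lebesgue) / ennreal l"
      by (rule nn_integral_divide) measurable
    finally have "?avg / ennreal l = (\<integral>\<^sup>+y\<in>ball a r. (e2ennreal \<bar>f y\<bar> / ennreal l) \<partial>lebesgue) / emeasure lebesgue (ball a r)"
      by (simp add: divide_ennreal_def mult_ac)
    also have "\<dots> \<le> ennreal ?\<kappa>' * ?gi"
      using ball_average_le_gen_inv[OF \<Phi> \<kappa> r S(2)[OF l], of a] by simp
    finally show "?avg \<le> ennreal ?\<kappa>' * ?gi * ennreal l" by (simp only: divide_le_ennreal_iff[OF l'])
  next
    show "ennreal ?\<kappa>' * ?gi \<noteq> 0" "ennreal ?\<kappa>' * ?gi \<noteq> top"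
      using \<kappa>' s by (simp_all add: ennreal_mult'[symmetric] ennreal_eq_0_iff not_le)
  qed
  then show ?thesis by (simp only: mult_ac)
qed

lemma AE_0_if_ball_integrals_0:
  fixes f :: "'n::finite fn"
  assumes f[measurable]: "f \<in> borel_measurable lebesgue"
    and 0: "\<And>r. r > 0 \<Longrightarrow> (\<integral>\<^sup>+y\<in>ball 0 r. e2ennreal \<bar>f y\<bar> \<partial>lebesgue) = 0"
  shows "AE x in lebesgue. f x = 0"
proof -
  have [measurable]: "ball 0 r \<in> sets (lebesgue :: (real ^ 'n) measure)" for r by simp
  have "AE x in lebesgue. \<forall>j. e2ennreal \<bar>f x\<bar> * indicator (ball 0 (real (Suc j))) x = 0"
  proof (subst AE_all_countable, intro allI)
    fix j
    show "AE x in lebesgue. e2ennreal \<bar>f x\<bar> * indicator (ball 0 (real (Suc j))) x = 0"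
      using 0[of "real (Suc j)"] by (subst nn_integral_0_iff_AE[symmetric]) (simp_all del: of_nat_Suc)
  qed
  then show ?thesis
  proof eventually_elim
    case (elim x)
    obtain j where "norm x < real (Suc j)" using reals_Archimedean2[of "norm x"] by (metis of_nat_Suc less_add_one less_trans add.commute)
    then have "e2ennreal \<bar>f x\<bar> = 0" using elim[rule_format, of j] by (simp add: indicator_def del: of_nat_Suc)
    then show ?case by (cases "f x") auto
  qed
qed

text \<open>A vanishing norm would make the average over every ball vanish. This justifies dividing
  by N f in the pointwise inequality.\<close>

lemma norm_ne_0:
  fixes f :: "'n::finite fn"
  assumes avg: "averages_bounded \<kappa> \<Phi> N" and f: "f \<in> fn_space N" and ne: "\<not> (AE x in lebesgue. f x = 0)"
  shows "N f \<noteq> 0"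
proof
  assume "N f = 0"
  then have "(\<integral>\<^sup>+y\<in>ball 0 r. e2ennreal \<bar>f y\<bar> \<partial>lebesgue) = 0" if "r > 0" for r
    using averages_boundedD[OF avg f that, of 0] ball_measure_pos[OF that, of "0 :: real ^ 'n"] by (simp del: emeasure_completion)
  then show False using AE_0_if_ball_integrals_0[of f] f ne by (auto simp: fn_space_def)
qed

lemma frac_maximal_AE_0:
  fixes f :: "'n::finite fn"
  assumes "AE x in lebesgue. f x = 0"
  shows "frac_maximal_op \<rho> f = (\<lambda>_. 0)"
proof -
  have "(\<integral>\<^sup>+y\<in>ball a r. e2ennreal \<bar>f y\<bar> \<partial>lebesgue) = 0" for a r
  proof -
    have "(\<integral>\<^sup>+y\<in>ball a r. e2ennreal \<bar>f y\<bar> \<partial>lebesgue) = (\<integral>\<^sup>+(y::real^'n). 0 \<partial>lebesgue)"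
      by (rule nn_integral_cong_AE) (use assms in eventually_elim, simp add: e2ennreal_neg)
    then show ?thesis by simp
  qed
  then have "\<not> 0 < frac_maximal \<rho> f x" for x by (simp add: less_frac_maximal_iff)
  then have "frac_maximal \<rho> f x = 0" for x by simp
  then show ?thesis by (simp add: frac_maximal_op_def zero_ennreal.rep_eq)
qed

text \<open>Functions vanishing almost everywhere are outside the scope of the pointwise inequality;
  they are settled here by \<open>zero\<close>.\<close>

lemma bounded_frac_maximal_opI:
  fixes N N' :: "'n::finite fn \<Rightarrow> ennreal"
  assumes C: "C > 0" and zero: "N' (\<lambda>_. 0) = 0"
    and le: "\<And>f. f \<in> fn_space N \<Longrightarrow> \<not> (AE x in lebesgue. f x = 0) \<Longrightarrow> N' (frac_maximal_op \<rho> f) \<le> ennreal C * N f"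
  shows "bounded_operator (frac_maximal_op \<rho>) N N'"
  unfolding bounded_operator_def
proof (intro exI[of _ C] conjI C ballI)
  fix f assume f: "f \<in> fn_space N"
  show le': "N' (frac_maximal_op \<rho> f) \<le> ennreal C * N f"
    using le[OF f] frac_maximal_AE_0[of f \<rho>] zero by (cases "AE x in lebesgue. f x = 0") auto
  have "ennreal C * N f < top" using f by (auto simp: fn_space_def ennreal_mult_less_top)
  moreover have "frac_maximal_op \<rho> f \<in> borel_measurable lebesgue"
    unfolding frac_maximal_op_def using frac_maximal_measurable[of \<rho> f] by measurable
  ultimately show "frac_maximal_op \<rho> f \<in> fn_space N'" using le' by (simp add: fn_space_def)
qed

lemma orlicz_norm_0:
  assumes "\<Phi> \<in> Phi_bar" shows "orlicz_norm \<Phi> (\<lambda>_. 0) = 0"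
  by (rule le_ennreal_all_eq_0)
    (auto simp: orlicz_norm_eq Phi_bar_zero[OF assms] e2ennreal_neg intro!: INF_lower)

lemma weak_orlicz_norm_0: "weak_orlicz_norm \<Phi> (\<lambda>_. 0) = 0"
  by (rule le_ennreal_all_eq_0) (auto simp: weak_orlicz_norm_eq weak_modular_le_1_def e2ennreal_neg intro!: INF_lower)

lemma orlicz_norm_frac_maximal_le:
  assumes "L > 0" "(\<integral>\<^sup>+x. \<Psi> (frac_maximal \<rho> f x / ennreal L) \<partial>lebesgue) \<le> 1"
  shows "orlicz_norm \<Psi> (frac_maximal_op \<rho> f) \<le> ennreal L"
  unfolding orlicz_norm_eq frac_maximal_op_def using assms by (intro INF_lower) simp

lemma weak_orlicz_norm_frac_maximal_le:
  assumes "L > 0" "weak_modular_le_1 \<Psi> (\<lambda>x. frac_maximal \<rho> f x / ennreal L)"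
  shows "weak_orlicz_norm \<Psi> (frac_maximal_op \<rho> f) \<le> ennreal L"
  unfolding weak_orlicz_norm_eq frac_maximal_op_def using assms by (intro INF_lower) simp

section \<open>Constants for the strong and weak Orlicz spaces\<close>

lemma orlicz_average_bound:
  assumes "\<Phi> \<in> Phi_bar_Y"
  shows "\<exists>\<kappa> > 0. averages_bounded \<kappa> \<Phi> (orlicz_norm \<Phi> :: 'n::finite fn \<Rightarrow> ennreal)"
proof -
  have \<Phi>: "\<Phi> \<in> Phi_bar" by (rule Phi_bar_Y_subset[OF assms])
  obtain c where c: "c \<ge> 1" "\<And>\<theta> t. \<theta> \<ge> 1 \<Longrightarrow> ennreal \<theta> * \<Phi> t \<le> \<Phi> (ennreal (c * \<theta>) * t)"
    using Phi_bar_Y_scale[OF assms] by metis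
  show ?thesis
  proof (intro exI conjI averages_boundedI)
    show "c * (1 + 1 / unit_ball_vol (real CARD('n))) > 0" using c by (simp add: add_pos_nonneg)
    fix f :: "'n fn" and a r assume f: "f \<in> orlicz_space \<Phi>" and r: "r > (0::real)"
    from f have fm[measurable]: "f \<in> borel_measurable lebesgue" by (simp add: fn_space_def)
    show "(\<integral>\<^sup>+y\<in>ball a r. e2ennreal \<bar>f y\<bar> \<partial>lebesgue) / emeasure lebesgue (ball a r)
      \<le> ennreal (c * (1 + 1 / unit_ball_vol (real CARD('n)))) * orlicz_norm \<Phi> f * gen_inv \<Phi> (ennreal (1 / r ^ CARD('n)))"
      unfolding orlicz_norm_eq using c
      by (intro average_le_norm[OF \<Phi> _ fm r] splits_at_levels_modular[OF \<Phi> c]) auto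
  qed
qed

lemma weak_orlicz_average_bound:
  assumes "\<Phi> \<in> nabla2_bar"
  shows "\<exists>\<kappa> > 0. averages_bounded \<kappa> \<Phi> (weak_orlicz_norm \<Phi> :: 'n::finite fn \<Rightarrow> ennreal)"
proof -
  have \<Phi>: "\<Phi> \<in> Phi_bar" using assms by (simp add: nabla2_bar_def)
  obtain k where k: "k > 1" "\<And>j t. ennreal ((2 * k) ^ j) * \<Phi> t \<le> \<Phi> (ennreal (k ^ j) * t)"
    using nabla2_bar_iterate[OF assms] by metis
  show ?thesis
  proof (intro exI conjI averages_boundedI)
    show "2 * k * (1 + 1 / unit_ball_vol (real CARD('n))) > 0" using k by (simp add: add_pos_nonneg)
    fix f :: "'n fn" and a r assume f: "f \<in> weak_orlicz_space \<Phi>" and r: "r > (0::real)"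
    from f have fm[measurable]: "f \<in> borel_measurable lebesgue" by (simp add: fn_space_def)
    show "(\<integral>\<^sup>+y\<in>ball a r. e2ennreal \<bar>f y\<bar> \<partial>lebesgue) / emeasure lebesgue (ball a r)
      \<le> ennreal (2 * k * (1 + 1 / unit_ball_vol (real CARD('n)))) * weak_orlicz_norm \<Phi> f * gen_inv \<Phi> (ennreal (1 / r ^ CARD('n)))"
      unfolding weak_orlicz_norm_eq using k
      by (intro average_le_norm[OF \<Phi> _ fm r] splits_at_levels_weak_modular[OF k]) auto
  qed
qed

lemma orlicz_weak_modular_HL:
  assumes "\<Phi> \<in> Phi_bar_Y"
  shows "\<exists>D > 0. \<forall>f :: 'n::finite fn. \<forall>\<nu> > 0. f \<in> orlicz_space \<Phi> \<and> orlicz_norm \<Phi> f = ennreal \<nu> \<longrightarrow>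
    weak_modular_le_1 \<Phi> (\<lambda>x. HL_maximal f x / ennreal (D * \<nu>))"
proof -
  have \<Phi>: "\<Phi> \<in> Phi_bar" by (rule Phi_bar_Y_subset[OF assms])
  obtain c where c: "c \<ge> 1" "\<And>\<theta> t. \<theta> \<ge> 1 \<Longrightarrow> ennreal \<theta> * \<Phi> t \<le> \<Phi> (ennreal (c * \<theta>) * t)"
    using Phi_bar_Y_scale[OF assms] by metis
  \<comment> \<open>The scaling inequality with \<theta> = 5^n.\<close>
  define q where "q = c * 5 ^ CARD('n)"
  have q: "q > 0" using c by (simp add: q_def)
  show ?thesis
  proof (intro exI conjI allI impI)
    \<comment> \<open>The factor 2 c q comes from \<open>weak_modular_HL_maximal\<close> with
      \<kappa> = c, the last 2 from working at 2 \<nu>.\<close>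
    show "2 * c * q * 2 > 0" using c q by simp
    fix f :: "'n fn" and \<nu> :: real assume \<nu>0: "\<nu> > 0" and f\<nu>: "f \<in> orlicz_space \<Phi> \<and> orlicz_norm \<Phi> f = ennreal \<nu>"
    then have f: "f \<in> orlicz_space \<Phi>" and \<nu>: "\<nu> > 0" "orlicz_norm \<Phi> f = ennreal \<nu>" by auto
    from f have fm[measurable]: "f \<in> borel_measurable lebesgue" by (simp add: fn_space_def)
    have "weak_modular_le_1 \<Phi> (\<lambda>x. HL_maximal f x / ennreal (2 * c * q * (2 * \<nu>)))"
    proof (rule weak_modular_HL_maximal[OF _ fm])
      show "splits_at_levels \<Phi> c (\<lambda>y. e2ennreal \<bar>f y\<bar> / ennreal (2 * \<nu>))"
        using \<nu> by (intro splits_at_levels_modular[OF \<Phi> c] modular_above_orlicz_norm[OF \<Phi>]) (simp_all add: ennreal_less_iff)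
      show "5 ^ CARD('n) * \<Phi> t \<le> \<Phi> (ennreal q * t)" for t
        using c(2)[of "5 ^ CARD('n)" t] by (simp add: q_def ennreal_power[symmetric])
    qed (use \<nu> c q in auto)
    then show "weak_modular_le_1 \<Phi> (\<lambda>x. HL_maximal f x / ennreal (2 * c * q * 2 * \<nu>))" by (simp only: mult.assoc)
  qed
qed

lemma weak_orlicz_weak_modular_HL:
  assumes "\<Phi> \<in> nabla2_bar"
  shows "\<exists>D > 0. \<forall>f :: 'n::finite fn. \<forall>\<nu> > 0. f \<in> weak_orlicz_space \<Phi> \<and> weak_orlicz_norm \<Phi> f = ennreal \<nu> \<longrightarrow>
    weak_modular_le_1 \<Phi> (\<lambda>x. HL_maximal f x / ennreal (D * \<nu>))"
proof -
  have \<Phi>: "\<Phi> \<in> Phi_bar" using assms by (simp add: nabla2_bar_def)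
  obtain k where k: "k > 1" "\<And>j t. ennreal ((2 * k) ^ j) * \<Phi> t \<le> \<Phi> (ennreal (k ^ j) * t)"
    using nabla2_bar_iterate[OF assms] by metis
  have "2 * k > 1" using k by simp
  then obtain m where m: "5 ^ CARD('n) < (2 * k) ^ m" using real_arch_pow by blast
  define q where "q = k ^ m"
  have q: "q > 0" using k by (simp add: q_def)
  show ?thesis
  proof (intro exI conjI allI impI)
    show "2 * (2 * k) * q * 2 > 0" using k q by simp
    fix f :: "'n fn" and \<nu> :: real assume \<nu>0: "\<nu> > 0" and f\<nu>: "f \<in> weak_orlicz_space \<Phi> \<and> weak_orlicz_norm \<Phi> f = ennreal \<nu>"
    then have f: "f \<in> weak_orlicz_space \<Phi>" and \<nu>: "\<nu> > 0" "weak_orlicz_norm \<Phi> f = ennreal \<nu>" by auto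
    from f have fm[measurable]: "f \<in> borel_measurable lebesgue" by (simp add: fn_space_def)
    have "weak_modular_le_1 \<Phi> (\<lambda>x. HL_maximal f x / ennreal (2 * (2 * k) * q * (2 * \<nu>)))"
    proof (rule weak_modular_HL_maximal[OF _ fm])
      show "splits_at_levels \<Phi> (2 * k) (\<lambda>y. e2ennreal \<bar>f y\<bar> / ennreal (2 * \<nu>))"
        using \<nu> by (intro splits_at_levels_weak_modular[OF k] weak_modular_above_weak_orlicz_norm) (simp_all add: ennreal_less_iff)
      fix t
      have "(5::ennreal) ^ CARD('n) = ennreal (5 ^ CARD('n))" by (simp add: ennreal_power[symmetric])
      also have "\<dots> \<le> ennreal ((2 * k) ^ m)" using m by (intro ennreal_leI) simp
      finally have "5 ^ CARD('n) * \<Phi> t \<le> ennreal ((2 * k) ^ m) * \<Phi> t" by (rule mult_right_mono) simp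
      also have "\<dots> \<le> \<Phi> (ennreal q * t)" unfolding q_def by (rule k(2))
      finally show "5 ^ CARD('n) * \<Phi> t \<le> \<Phi> (ennreal q * t)" .
    qed (use \<nu> k q in auto)
    then show "weak_modular_le_1 \<Phi> (\<lambda>x. HL_maximal f x / ennreal (2 * (2 * k) * q * 2 * \<nu>))" by (simp only: mult.assoc)
  qed
qed

lemma orlicz_modular_HL:
  assumes "\<Phi> \<in> nabla2_bar"
  shows "\<exists>D > 0. \<forall>f :: 'n::finite fn. \<forall>\<nu> > 0. f \<in> orlicz_space \<Phi> \<and> orlicz_norm \<Phi> f = ennreal \<nu> \<longrightarrow>
    (\<integral>\<^sup>+x. \<Phi> (HL_maximal f x / ennreal (D * \<nu>)) \<partial>lebesgue) \<le> 1"
proof -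
  have \<Phi>: "\<Phi> \<in> Phi_bar" using assms by (simp add: nabla2_bar_def)
  obtain k where k: "k > 1" "\<And>j t. ennreal ((2 * k) ^ j) * \<Phi> t \<le> \<Phi> (ennreal (k ^ j) * t)"
    using nabla2_bar_iterate[OF assms] by metis
  have "2 * k > 1" using k by simp
  then obtain m where m: "2 * k * 5 ^ CARD('n) < (2 * k) ^ m" using real_arch_pow by blast
  show ?thesis
  proof (intro exI conjI allI impI)
    show "2 * k * k ^ m * 2 > 0" using k by simp
    fix f :: "'n fn" and \<nu> :: real assume \<nu>0: "\<nu> > 0" and f\<nu>: "f \<in> orlicz_space \<Phi> \<and> orlicz_norm \<Phi> f = ennreal \<nu>"
    then have f: "f \<in> orlicz_space \<Phi>" and \<nu>: "\<nu> > 0" "orlicz_norm \<Phi> f = ennreal \<nu>" by auto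
    from f have fm[measurable]: "f \<in> borel_measurable lebesgue" by (simp add: fn_space_def)
    have "(\<integral>\<^sup>+x. \<Phi> (HL_maximal f x / ennreal (2 * k * k ^ m * (2 * \<nu>))) \<partial>lebesgue) \<le> 1"
      using \<nu> by (intro modular_HL_maximal[OF \<Phi> _ fm k less_imp_le[OF m]] modular_above_orlicz_norm[OF \<Phi>]) (simp_all add: ennreal_less_iff)
    then show "(\<integral>\<^sup>+x. \<Phi> (HL_maximal f x / ennreal (2 * k * k ^ m * 2 * \<nu>)) \<partial>lebesgue) \<le> 1" by (simp only: mult.assoc)
  qed
qed

section \<open>Necessity and the main theorem\<close>

text \<open>At scale \<kappa> / s the modular of the indicator is \<Phi> (s / \<kappa>) times
  \<omega> R^n. Scaling trades the volume \<omega> for a dilation, and \<Phi> s \<le> 1 / R^n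
  because s is the inverse at 1 / R^n.\<close>

lemma orlicz_norm_indicator_ball_le:
  assumes "\<Phi> \<in> Phi_bar_Y"
  shows "\<exists>\<kappa> > 0. \<forall>R > 0. \<forall>s > 0. gen_inv \<Phi> (ennreal (1 / R ^ CARD('n))) = ennreal s \<longrightarrow>
    orlicz_norm \<Phi> (indicator (ball 0 R) :: 'n::finite fn) \<le> ennreal (\<kappa> / s)"
proof -
  have \<Phi>: "\<Phi> \<in> Phi_bar" by (rule Phi_bar_Y_subset[OF assms])
  obtain c where c: "c \<ge> 1" "\<And>\<theta> t. \<theta> \<ge> 1 \<Longrightarrow> ennreal \<theta> * \<Phi> t \<le> \<Phi> (ennreal (c * \<theta>) * t)"
    using Phi_bar_Y_scale[OF assms] by metis
  define \<omega> where "\<omega> = unit_ball_vol (real CARD('n))"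
  \<comment> \<open>The unit ball may have volume below 1, while the scaling inequality needs a
    factor of at least 1.\<close>
  define \<theta> where "\<theta> = max 1 \<omega>"
  have \<theta>: "\<theta> \<ge> 1" "\<omega> \<le> \<theta>" by (simp_all add: \<theta>_def)
  show ?thesis
  proof (intro exI conjI allI impI)
    show \<kappa>: "c * \<theta> > 0" using c \<theta> by simp
    fix R s :: real assume R: "R > 0" and s: "s > 0" "gen_inv \<Phi> (ennreal (1 / R ^ CARD('n))) = ennreal s"
    let ?f = "indicator (ball 0 R) :: 'n fn"
    have inv: "1 / ennreal (c * \<theta> / s) = ennreal (s / (c * \<theta>))"
      using divide_ennreal[of 1 "c * \<theta> / s"] \<kappa> s by simp
    have "(\<integral>\<^sup>+x. \<Phi> (e2ennreal \<bar>?f x\<bar> / ennreal (c * \<theta> / s)) \<partial>lebesgue)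
      = (\<integral>\<^sup>+(x::real^'n). \<Phi> (ennreal (s / (c * \<theta>))) * indicator (ball 0 R) x \<partial>lebesgue)"
      using \<kappa> s by (intro nn_integral_cong)
        (auto simp: indicator_def Phi_bar_zero[OF \<Phi>] e2ennreal_neg one_ereal_def inv)
    also have "\<dots> = \<Phi> (ennreal (s / (c * \<theta>))) * ennreal (\<omega> * R ^ CARD('n))"
      using emeasure_lebesgue_ball[OF R, of "0 :: real ^ 'n"] by (subst nn_integral_cmult_indicator) (simp_all add: \<omega>_def)
    also have "\<dots> \<le> \<Phi> (ennreal (s / (c * \<theta>))) * ennreal (\<theta> * R ^ CARD('n))"
      using \<theta> R by (intro mult_left_mono ennreal_leI) auto
    also have "\<dots> = (ennreal \<theta> * \<Phi> (ennreal (s / (c * \<theta>)))) * ennreal (R ^ CARD('n))"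
      using \<theta> by (simp add: ennreal_mult' mult_ac)
    also have "\<dots> \<le> \<Phi> (ennreal (c * \<theta>) * ennreal (s / (c * \<theta>))) * ennreal (R ^ CARD('n))"
      by (intro mult_right_mono c(2) \<theta>) simp
    also have "ennreal (c * \<theta>) * ennreal (s / (c * \<theta>)) = gen_inv \<Phi> (ennreal (1 / R ^ CARD('n)))"
      using \<kappa> c \<theta> s by (simp add: ennreal_mult'[symmetric])
    also have "\<Phi> (gen_inv \<Phi> (ennreal (1 / R ^ CARD('n)))) * ennreal (R ^ CARD('n)) \<le> ennreal (1 / R ^ CARD('n)) * ennreal (R ^ CARD('n))"
      using gen_inv_less_iff[OF \<Phi>, of "ennreal (1 / R ^ CARD('n))" "gen_inv \<Phi> (ennreal (1 / R ^ CARD('n)))"]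
      by (intro mult_right_mono) (simp_all add: not_less[symmetric])
    also have "\<dots> = 1" using R by (simp add: ennreal_mult'[symmetric])
    finally show "orlicz_norm \<Phi> ?f \<le> ennreal (c * \<theta> / s)"
      unfolding orlicz_norm_eq using \<kappa> s by (intro INF_lower) auto
  qed
qed

text \<open>A ball of radius \<open>t \<le> R\<close> through \<open>x\<close> inside \<open>ball 0 R\<close> is centred at \<open>(1 - t / R) x\<close>.\<close>

lemma frac_maximal_indicator_ball_ge:
  fixes x :: "real ^ 'n::finite"
  assumes x: "x \<in> ball 0 R"
  shows "(SUP t\<in>{0<..R}. ennreal (\<rho> t)) \<le> frac_maximal \<rho> (indicator (ball 0 R)) x"
proof (rule SUP_least)
  fix t assume t: "t \<in> {0<..R}"
  define a where "a = (1 - t / R) *\<^sub>R x"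
  have R: "R > 0" "t \<le> R" "t > 0" using t by auto
  have nx: "norm x < R" using x by simp
  have "x - a = (t / R) *\<^sub>R x" by (simp add: a_def algebra_simps)
  moreover have "dist a x = norm (x - a)" by (metis dist_commute dist_norm)
  ultimately have "dist a x = t * (norm x / R)" using R by simp
  also have "\<dots> < t * 1" using R nx by (intro mult_strict_left_mono) auto
  finally have xa: "x \<in> ball a t" by simp
  have "norm a = (1 - t / R) * norm x" using R by (simp add: a_def)
  also have "\<dots> \<le> (1 - t / R) * R" using R nx by (intro mult_left_mono) auto
  also have "\<dots> = R - t" using R by (simp add: field_simps)
  finally have sub: "ball a t \<subseteq> ball 0 R" using norm_triangle_ineq2 by (auto simp: ball_subset_ball_iff dist_norm)
  have "(\<integral>\<^sup>+y\<in>ball a t. e2ennreal \<bar>indicator (ball 0 R) y\<bar> \<partial>lebesgue) = (\<integral>\<^sup>+y. indicator (ball a t) y \<partial>lebesgue)"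
    using sub by (intro nn_integral_cong) (auto simp: indicator_def one_ereal_def)
  also have "\<dots> = emeasure lebesgue (ball a t)" by simp
  finally have "(\<integral>\<^sup>+y\<in>ball a t. e2ennreal \<bar>indicator (ball 0 R) y\<bar> \<partial>lebesgue) / emeasure lebesgue (ball a t) = 1"
    using ball_measure_pos[OF R(3), of a] by (simp add: top.not_eq_extremum del: emeasure_completion)
  then show "ennreal (\<rho> t) \<le> frac_maximal \<rho> (indicator (ball 0 R)) x"
    using frac_maximal_upper[OF R(3) xa, of \<rho> "indicator (ball 0 R)"] by simp
qed

text \<open>The counterpart of \<open>averages_bounded\<close> for the target: a lower bound for N
  on functions that are large on a ball. Both necessity claims go through it.\<close>

definition large_on_balls :: "real \<Rightarrow> (ennreal \<Rightarrow> ennreal) \<Rightarrow> ('n::finite fn \<Rightarrow> ennreal) \<Rightarrow> bool" where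
  "large_on_balls \<kappa> \<Psi> N \<longleftrightarrow> (\<forall>h \<in> borel_measurable lebesgue. \<forall>R > 0. \<forall>S. (\<forall>x \<in> ball 0 R. S \<le> h x) \<longrightarrow>
     S \<le> ennreal \<kappa> * gen_inv \<Psi> (ennreal (1 / R ^ CARD('n))) * N (\<lambda>x. enn2ereal (h x)))"

lemma large_on_ballsI:
  fixes N :: "'n::finite fn \<Rightarrow> ennreal"
  assumes "\<And>h R S. h \<in> borel_measurable lebesgue \<Longrightarrow> R > 0 \<Longrightarrow> (\<And>x. x \<in> ball 0 R \<Longrightarrow> S \<le> h x) \<Longrightarrow>
    S \<le> ennreal \<kappa> * gen_inv \<Psi> (ennreal (1 / R ^ CARD('n))) * N (\<lambda>x. enn2ereal (h x))"
  shows "large_on_balls \<kappa> \<Psi> N"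
  unfolding large_on_balls_def by (intro ballI allI impI assms) auto

lemma large_on_ballsD:
  fixes N :: "'n::finite fn \<Rightarrow> ennreal"
  assumes "large_on_balls \<kappa> \<Psi> N" "h \<in> borel_measurable lebesgue" "R > 0" "\<And>x. x \<in> ball 0 R \<Longrightarrow> S \<le> h x"
  shows "S \<le> ennreal \<kappa> * gen_inv \<Psi> (ennreal (1 / R ^ CARD('n))) * N (\<lambda>x. enn2ereal (h x))"
  using assms(1)[unfolded large_on_balls_def, rule_format, OF assms(2,3)] assms(4) by blast

lemma weak_orlicz_norm_ge_on_ball:
  assumes "\<Psi> \<in> Phi_bar_Y"
  shows "\<exists>\<kappa> > 0. large_on_balls \<kappa> \<Psi> (weak_orlicz_norm \<Psi> :: 'n::finite fn \<Rightarrow> ennreal)"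
proof -
  have \<Psi>: "\<Psi> \<in> Phi_bar" by (rule Phi_bar_Y_subset[OF assms])
  obtain c where c: "c \<ge> 1" "\<And>\<theta> t. \<theta> \<ge> 1 \<Longrightarrow> ennreal \<theta> * \<Psi> t \<le> \<Psi> (ennreal (c * \<theta>) * t)"
    using Phi_bar_Y_scale[OF assms] by metis
  define \<omega> where "\<omega> = unit_ball_vol (real CARD('n))"
  have \<omega>: "\<omega> > 0" by (simp add: \<omega>_def)
  \<comment> \<open>Now \<theta> \<omega> \<ge> 1 is wanted, so that R^n is at most \<theta> times
    the volume of the ball.\<close>
  define \<theta> where "\<theta> = max 1 (1 / \<omega>)"
  have \<theta>: "\<theta> \<ge> 1" "1 \<le> \<theta> * \<omega>" using \<omega> by (simp_all add: \<theta>_def field_simps max_def)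
  show ?thesis
  proof (intro exI conjI large_on_ballsI)
    show \<kappa>: "c * \<theta> > 0" using c \<theta> by simp
    fix h :: "real ^ 'n \<Rightarrow> ennreal" and R :: real and S
    assume h[measurable]: "h \<in> borel_measurable lebesgue" and R: "R > 0" and S: "\<And>x. x \<in> ball 0 R \<Longrightarrow> S \<le> h x"
    let ?u = "ennreal (1 / R ^ CARD('n))"
    obtain s where s: "gen_inv \<Psi> ?u = ennreal s" "s > 0" using gen_inv_real[OF \<Psi>, of "1 / R ^ CARD('n)"] R by auto
    show "S \<le> ennreal (c * \<theta>) * gen_inv \<Psi> ?u * weak_orlicz_norm \<Psi> (\<lambda>x. enn2ereal (h x))"
      unfolding weak_orlicz_norm_eq
    proof (rule le_mult_INF_ennreal)
      show "ennreal (c * \<theta>) * gen_inv \<Psi> ?u \<noteq> 0" "ennreal (c * \<theta>) * gen_inv \<Psi> ?u \<noteq> top"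
        using \<kappa> c \<theta> s by (simp_all add: ennreal_mult'[symmetric])
      fix l assume "l \<in> {l. l > 0 \<and> weak_modular_le_1 \<Psi> (\<lambda>x. e2ennreal \<bar>enn2ereal (h x)\<bar> / ennreal l)}"
      then have l: "l > 0" and W: "weak_modular_le_1 \<Psi> (\<lambda>x. h x / ennreal l)" by simp_all
      have l': "ennreal l \<noteq> 0" "ennreal l \<noteq> top" using l by simp_all
      have "S / ennreal l \<le> ennreal (c * \<theta>) * gen_inv \<Psi> ?u"
      \<comment> \<open>Level sets are strict, so the ball lies in the level set of h / l only for
        levels t strictly below S / l.\<close>
      proof (rule dense_le)
        fix y assume y: "y < S / ennreal l"
        then have "y < top" by (auto intro: less_le_trans)
        then obtain t where t: "y = ennreal t" "t \<ge> 0" by (cases y) auto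
        show "y \<le> ennreal (c * \<theta>) * gen_inv \<Psi> ?u"
        proof (cases "t = 0")
          case False
          have "ball 0 R \<subseteq> {x. ennreal t < h x / ennreal l}"
            using y t S by (auto simp: less_divide_ennreal_iff[OF l'] intro: less_le_trans)
          moreover have "{x. ennreal t < h x / ennreal l} \<in> sets lebesgue" by (rule sets_superlevel) measurable
          ultimately have "emeasure lebesgue (ball 0 R :: (real ^ 'n) set) \<le> emeasure lebesgue {x. ennreal t < h x / ennreal l}"
            by (rule emeasure_mono)
          then have "\<Psi> (ennreal t) * ennreal (\<omega> * R ^ CARD('n)) \<le> \<Psi> (ennreal t) * emeasure lebesgue {x. ennreal t < h x / ennreal l}"
            using emeasure_lebesgue_ball[OF R, of "0 :: real ^ 'n"] by (intro mult_left_mono) (simp_all add: \<omega>_def)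
          also have "\<dots> \<le> 1" using W t False unfolding weak_modular_le_1_def by simp
          finally have le1: "\<Psi> (ennreal t) * ennreal (\<omega> * R ^ CARD('n)) \<le> 1" .
          have "\<Psi> (ennreal (t / (c * \<theta>))) * ennreal (R ^ CARD('n)) \<le> \<Psi> (ennreal (t / (c * \<theta>))) * ennreal (\<theta> * (\<omega> * R ^ CARD('n)))"
            using \<theta> R by (intro mult_left_mono ennreal_leI) (auto simp: mult.assoc[symmetric])
          also have "\<dots> = (ennreal \<theta> * \<Psi> (ennreal (t / (c * \<theta>)))) * ennreal (\<omega> * R ^ CARD('n))"
            unfolding ennreal_mult'[OF order_trans[OF zero_le_one \<theta>(1)]] by (simp only: mult_ac)
          also have "\<dots> \<le> \<Psi> (ennreal (c * \<theta>) * ennreal (t / (c * \<theta>))) * ennreal (\<omega> * R ^ CARD('n))"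
            by (intro mult_right_mono c(2) \<theta>) simp
          also have "ennreal (c * \<theta>) * ennreal (t / (c * \<theta>)) = ennreal t"
            using c \<theta> by (simp add: ennreal_mult'[symmetric])
          also note le1
          finally have "\<Psi> (ennreal (t / (c * \<theta>))) * ennreal (R ^ CARD('n)) * ?u \<le> 1 * ?u"
            by (rule mult_right_mono) simp
          then have "\<Psi> (ennreal (t / (c * \<theta>))) \<le> ?u"
            using R by (simp add: mult.assoc ennreal_mult'[symmetric])
          then have "ennreal (t / (c * \<theta>)) \<le> gen_inv \<Psi> ?u"
            using gen_inv_less_iff[OF \<Psi>, of ?u "ennreal (t / (c * \<theta>))"] by (simp add: not_less[symmetric])
          then have "ennreal (c * \<theta>) * ennreal (t / (c * \<theta>)) \<le> ennreal (c * \<theta>) * gen_inv \<Psi> ?u"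
            by (rule mult_left_mono) simp
          then show ?thesis using t c \<theta> by (simp add: ennreal_mult'[symmetric])
        qed (simp add: t)
      qed
      then show "S \<le> ennreal (c * \<theta>) * gen_inv \<Psi> ?u * ennreal l" by (simp only: divide_le_ennreal_iff[OF l'])
    qed
  qed
qed

lemma L1psi_norm_ge_on_ball:
  fixes h :: "real ^ 'n::finite \<Rightarrow> ennreal"
  assumes h: "h \<in> borel_measurable lebesgue" and R: "R > 0" and \<psi>: "\<psi> R \<noteq> 0" "\<psi> R \<noteq> top"
    and S: "\<And>x. x \<in> ball 0 R \<Longrightarrow> S \<le> h x"
  shows "S \<le> \<psi> R * L1psi_norm \<psi> (\<lambda>x. enn2ereal (h x))"
proof -
  let ?m = "emeasure lebesgue (ball 0 R :: (real ^ 'n) set)"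
  note m = ball_measure_pos[OF R, of "0 :: real ^ 'n"]
  have "S * ?m = (\<integral>\<^sup>+(y::real^'n). S * indicator (ball 0 R) y \<partial>lebesgue)"
    by (rule nn_integral_cmult_indicator[symmetric]) simp
  also have "\<dots> \<le> (\<integral>\<^sup>+y\<in>ball 0 R. h y \<partial>lebesgue)"
    using S by (intro nn_integral_mono) (auto simp: indicator_def)
  finally have "S * ?m / (\<psi> R * ?m) \<le> (\<integral>\<^sup>+y\<in>ball 0 R. h y \<partial>lebesgue) / (\<psi> R * ?m)"
    by (rule divide_right_mono_ennreal)
  also have "\<dots> \<le> L1psi_norm \<psi> (\<lambda>x. enn2ereal (h x))"
    unfolding L1psi_norm_def using R by (intro SUP_upper2[of "(0, R)"]) (auto simp del: emeasure_completion)
  finally have "S / \<psi> R \<le> L1psi_norm \<psi> (\<lambda>x. enn2ereal (h x))"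
    using m by (simp only: divide_mult_eq infinity_ennreal_def not_False_eq_True)
  then show ?thesis by (simp only: divide_le_ennreal_iff[OF \<psi>] mult.commute)
qed

lemma sup_rho_condition_necessary:
  assumes \<Phi>: "\<Phi> \<in> Phi_bar_Y" and \<Psi>: "\<Psi> \<in> Phi_bar_Y"
    and bdd: "bounded_operator (frac_maximal_op \<rho> :: 'n::finite fn \<Rightarrow> 'n fn) (orlicz_norm \<Phi>) N'"
    and \<kappa>: "\<kappa> > 0" and ge: "large_on_balls \<kappa> \<Psi> N'"
  shows "\<exists>A > 0. sup_rho_condition CARD('n) \<rho> \<Phi> \<Psi> A"
proof -
  obtain \<kappa>' where \<kappa>': "\<kappa>' > 0" and ind: "\<forall>R > 0. \<forall>s > 0. gen_inv \<Phi> (ennreal (1 / R ^ CARD('n))) = ennreal s \<longrightarrow>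
    orlicz_norm \<Phi> (indicator (ball 0 R) :: 'n fn) \<le> ennreal (\<kappa>' / s)"
    using orlicz_norm_indicator_ball_le[OF \<Phi>] by blast
  obtain C where C: "C > 0" and le: "\<And>f :: 'n fn. f \<in> orlicz_space \<Phi> \<Longrightarrow> N' (frac_maximal_op \<rho> f) \<le> ennreal C * orlicz_norm \<Phi> f"
    using bdd unfolding bounded_operator_def by blast
  show ?thesis
  proof (intro exI conjI)
    \<comment> \<open>The product of the lower bound constant of the target, the operator bound and
      the constant in the norm of the indicator.\<close>
    show "\<kappa> * C * \<kappa>' > 0" using \<kappa> C \<kappa>' by simp
    show "sup_rho_condition CARD('n) \<rho> \<Phi> \<Psi> (\<kappa> * C * \<kappa>')"
      unfolding sup_rho_condition_def
    proof (intro allI impI)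
      fix R :: real assume R: "R > 0"
      let ?f = "indicator (ball 0 R) :: 'n fn"
      let ?S = "SUP t\<in>{0<..R}. ennreal (\<rho> t)"
      let ?u = "ennreal (1 / R ^ CARD('n))"
      obtain s where s: "gen_inv \<Phi> ?u = ennreal s" "s > 0"
        using gen_inv_real[OF Phi_bar_Y_subset[OF \<Phi>], of "1 / R ^ CARD('n)"] R by auto
      note nf = ind[rule_format, OF R s(2,1)]
      have "orlicz_norm \<Phi> ?f < top" using nf by (auto intro: le_less_trans)
      moreover have "?f \<in> borel_measurable lebesgue" by (intro borel_measurable_indicator) simp
      ultimately have f: "?f \<in> orlicz_space \<Phi>" by (simp add: fn_space_def)
      have "?S \<le> ennreal \<kappa> * gen_inv \<Psi> ?u * N' (frac_maximal_op \<rho> ?f)"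
        unfolding frac_maximal_op_def by (intro large_on_ballsD[OF ge] frac_maximal_measurable R frac_maximal_indicator_ball_ge)
      also have "\<dots> \<le> ennreal \<kappa> * gen_inv \<Psi> ?u * (ennreal C * ennreal (\<kappa>' / s))"
        by (intro mult_left_mono order_trans[OF le[OF f]] nf) auto
      finally have "?S * ennreal s \<le> ennreal \<kappa> * gen_inv \<Psi> ?u * (ennreal C * ennreal (\<kappa>' / s)) * ennreal s"
        by (rule mult_right_mono) simp
      also have "\<dots> = (ennreal \<kappa> * (ennreal C * (ennreal (\<kappa>' / s) * ennreal s))) * gen_inv \<Psi> ?u"
        by (simp only: mult_ac)
      also have "ennreal \<kappa> * (ennreal C * (ennreal (\<kappa>' / s) * ennreal s)) = ennreal (\<kappa> * C * \<kappa>')"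
        using \<kappa> C \<kappa>' s by (simp add: ennreal_mult'[symmetric] mult.assoc)
      finally show "?S * gen_inv \<Phi> ?u \<le> ennreal (\<kappa> * C * \<kappa>') * gen_inv \<Psi> ?u" using s by simp
    qed
  qed
qed

section \<open>From the pointwise inequality to boundedness\<close>

lemma frac_maximal_pointwise:
  fixes N :: "'n::finite fn \<Rightarrow> ennreal"
  assumes \<Phi>: "\<Phi> \<in> Phi_bar" and \<Psi>: "\<Psi> \<in> Phi_bar"
    and cond: "sup_rho_condition CARD('n) \<rho> \<Phi> \<Psi> A" and A: "A > 0" and C0: "C0 > 0"
    and avg: "averages_bounded \<kappa> \<Phi> N"
    and \<kappa>: "\<kappa> \<le> \<kappa>'"
    and f: "f \<in> fn_space N" "\<not> (AE x in lebesgue. f x = 0)"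
  shows "\<Psi> (frac_maximal \<rho> f x / (ennreal (A * max C0 \<kappa>') * N f)) \<le> \<Phi> (HL_maximal f x / (ennreal C0 * N f))"
proof (rule frac_maximal_hedberg[OF \<Phi> \<Psi> cond A C0])
  show "N f \<noteq> 0" by (rule norm_ne_0[OF avg f])
  show "N f \<noteq> top" using f(1) by (auto simp: fn_space_def)
  \<comment> \<open>Enlarging \<kappa> to \<kappa>' lets the strong and the weak inequality hold
    with the same \<open>C\<^sub>1\<close>.\<close>
  show "(\<integral>\<^sup>+y\<in>ball a r. e2ennreal \<bar>f y\<bar> \<partial>lebesgue) / emeasure lebesgue (ball a r)
      \<le> ennreal \<kappa>' * N f * gen_inv \<Phi> (ennreal (1 / r ^ CARD('n)))" if "r > 0" for a r
    using averages_boundedD[OF avg f(1) that] by (rule order_trans) (intro mult_right_mono ennreal_leI \<kappa>, auto)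
qed

text \<open>The pointwise inequality is used with \<open>C0\<close> = D. In the applications D \<nu>
  is a scale at which the strong or weak modular of M f is at most 1, and \<open>transfer\<close>
  carries this over to the fractional maximal function at scale L = A max(D, \<kappa>)
  \<nu>.\<close>

lemma frac_maximal_bounded:
  fixes N :: "'n::finite fn \<Rightarrow> ennreal"
  assumes \<Phi>: "\<Phi> \<in> Phi_bar" and \<Psi>: "\<Psi> \<in> Phi_bar"
    and cond: "sup_rho_condition CARD('n) \<rho> \<Phi> \<Psi> A" and A: "A > 0" and \<kappa>: "\<kappa> > 0" and D: "D > 0"
    and avg: "averages_bounded \<kappa> \<Phi> N"
    and zero: "N' (\<lambda>_. 0) = 0"
    and transfer: "\<And>(f :: 'n fn) \<nu> L. f \<in> fn_space N \<Longrightarrow> \<nu> > 0 \<Longrightarrow> N f = ennreal \<nu> \<Longrightarrow> L > 0 \<Longrightarrow>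
      (\<And>x. \<Psi> (frac_maximal \<rho> f x / ennreal L) \<le> \<Phi> (HL_maximal f x / ennreal (D * \<nu>))) \<Longrightarrow>
      N' (frac_maximal_op \<rho> f) \<le> ennreal L"
  shows "bounded_operator (frac_maximal_op \<rho>) N N'"
proof (rule bounded_frac_maximal_opI)
  show C: "A * max D \<kappa> > 0" using A D by simp
  fix f :: "'n fn" assume f: "f \<in> fn_space N" "\<not> (AE x in lebesgue. f x = 0)"
  have "N f \<noteq> 0" by (rule norm_ne_0[OF avg f])
  moreover have "N f < top" using f(1) by (auto simp: fn_space_def)
  ultimately obtain \<nu> where \<nu>: "N f = ennreal \<nu>" "\<nu> > 0" by (cases "N f") auto
  have "N' (frac_maximal_op \<rho> f) \<le> ennreal (A * max D \<kappa> * \<nu>)"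
  proof (rule transfer[OF f(1) \<nu>(2,1)])
    show "A * max D \<kappa> * \<nu> > 0" using C \<nu> by simp
    show "\<Psi> (frac_maximal \<rho> f x / ennreal (A * max D \<kappa> * \<nu>)) \<le> \<Phi> (HL_maximal f x / ennreal (D * \<nu>))" for x
      using frac_maximal_pointwise[OF \<Phi> \<Psi> cond A D avg order_refl f, of x] \<nu> C D
      by (simp add: ennreal_mult')
  qed
  then show "N' (frac_maximal_op \<rho> f) \<le> ennreal (A * max D \<kappa>) * N f"
    using C \<nu> by (simp add: ennreal_mult')
qed (rule zero)

theorem corollary3p9:
  fixes \<Phi> \<Psi> :: "ennreal \<Rightarrow> ennreal" and \<rho> :: "real \<Rightarrow> real"
  assumes "\<Phi> \<in> Phi_bar_Y" and "\<Psi> \<in> Phi_bar_Y" and "\<forall>r > 0. \<rho> r > 0"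
  shows
    "((\<exists>A > 0. sup_rho_condition CARD('n::finite) \<rho> \<Phi> \<Psi> A) \<longrightarrow>
        (\<forall>C\<^sub>0 :: real. C\<^sub>0 > 0 \<longrightarrow> (\<exists>C\<^sub>1 :: real. C\<^sub>1 > 0 \<and>
           (\<forall>f :: 'n fn. f \<in> orlicz_space \<Phi> \<and> \<not> (AE x in lebesgue. f x = 0) \<longrightarrow>
              (\<forall>x. \<Psi> (frac_maximal \<rho> f x / (ennreal C\<^sub>1 * orlicz_norm \<Phi> f))
                 \<le> \<Phi> (HL_maximal f x / (ennreal C\<^sub>0 * orlicz_norm \<Phi> f)))) \<and>
           (\<Phi> \<in> nabla2_bar \<longrightarrow>
             (\<forall>f :: 'n fn. f \<in> weak_orlicz_space \<Phi> \<and> \<not> (AE x in lebesgue. f x = 0) \<longrightarrow>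
                (\<forall>x. \<Psi> (frac_maximal \<rho> f x / (ennreal C\<^sub>1 * weak_orlicz_norm \<Phi> f))
                   \<le> \<Phi> (HL_maximal f x / (ennreal C\<^sub>0 * weak_orlicz_norm \<Phi> f))))))) \<and>
        bounded_operator (frac_maximal_op \<rho> :: 'n fn \<Rightarrow> 'n fn)
          (orlicz_norm \<Phi>) (weak_orlicz_norm \<Psi>) \<and>
        (\<Phi> \<in> nabla2_bar \<longrightarrow>
           bounded_operator (frac_maximal_op \<rho> :: 'n fn \<Rightarrow> 'n fn)
             (orlicz_norm \<Phi>) (orlicz_norm \<Psi>) \<and>
           bounded_operator (frac_maximal_op \<rho> :: 'n fn \<Rightarrow> 'n fn)
             (weak_orlicz_norm \<Phi>) (weak_orlicz_norm \<Psi>)))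
     \<and> (bounded_operator (frac_maximal_op \<rho> :: 'n fn \<Rightarrow> 'n fn)
          (orlicz_norm \<Phi>) (weak_orlicz_norm \<Psi>) \<longrightarrow>
        (\<exists>A > 0. sup_rho_condition CARD('n) \<rho> \<Phi> \<Psi> A))
     \<and> (bounded_operator (frac_maximal_op \<rho> :: 'n fn \<Rightarrow> 'n fn)
          (orlicz_norm \<Phi>) (L1psi_norm (\<lambda>r. gen_inv \<Psi> (ennreal (1 / r ^ CARD('n))))) \<longrightarrow>
        (\<exists>A > 0. sup_rho_condition CARD('n) \<rho> \<Phi> \<Psi> A))"
proof -
  have \<Phi>: "\<Phi> \<in> Phi_bar" and \<Psi>: "\<Psi> \<in> Phi_bar" using assms by (simp_all add: Phi_bar_Y_subset)
  obtain \<kappa>1 where \<kappa>1: "\<kappa>1 > 0" and avg1: "averages_bounded \<kappa>1 \<Phi> (orlicz_norm \<Phi> :: 'n fn \<Rightarrow> ennreal)"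
    using orlicz_average_bound[OF assms(1)] by blast
  \<comment> \<open>If \<Phi> is not in \<open>nabla2_bar\<close>, the bound is vacuous and any
    positive number will do.\<close>
  obtain \<kappa>2 where \<kappa>2: "\<kappa>2 > 0"
    and avg2: "\<Phi> \<in> nabla2_bar \<Longrightarrow> averages_bounded \<kappa>2 \<Phi> (weak_orlicz_norm \<Phi> :: 'n fn \<Rightarrow> ennreal)"
    using weak_orlicz_average_bound[of \<Phi>] zero_less_one by blast
  have HL_measurable: "(\<lambda>x. HL_maximal f x / ennreal l) \<in> borel_measurable lebesgue" for f :: "'n fn" and l
    by (intro borel_measurable_divide_ennreal frac_maximal_measurable) simp
  show ?thesis
  proof (intro conjI impI)
    assume "\<exists>A > 0. sup_rho_condition CARD('n) \<rho> \<Phi> \<Psi> A"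
    then obtain A where A: "A > 0" and cond: "sup_rho_condition CARD('n) \<rho> \<Phi> \<Psi> A" by blast
    show "\<forall>C\<^sub>0 :: real. C\<^sub>0 > 0 \<longrightarrow> (\<exists>C\<^sub>1 :: real. C\<^sub>1 > 0 \<and>
           (\<forall>f :: 'n fn. f \<in> orlicz_space \<Phi> \<and> \<not> (AE x in lebesgue. f x = 0) \<longrightarrow>
              (\<forall>x. \<Psi> (frac_maximal \<rho> f x / (ennreal C\<^sub>1 * orlicz_norm \<Phi> f))
                 \<le> \<Phi> (HL_maximal f x / (ennreal C\<^sub>0 * orlicz_norm \<Phi> f)))) \<and>
           (\<Phi> \<in> nabla2_bar \<longrightarrow>
             (\<forall>f :: 'n fn. f \<in> weak_orlicz_space \<Phi> \<and> \<not> (AE x in lebesgue. f x = 0) \<longrightarrow>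
                (\<forall>x. \<Psi> (frac_maximal \<rho> f x / (ennreal C\<^sub>1 * weak_orlicz_norm \<Phi> f))
                   \<le> \<Phi> (HL_maximal f x / (ennreal C\<^sub>0 * weak_orlicz_norm \<Phi> f))))))"
    proof (intro allI impI)
      fix C\<^sub>0 :: real assume C0: "C\<^sub>0 > 0"
      show "\<exists>C\<^sub>1 :: real. C\<^sub>1 > 0 \<and>
           (\<forall>f :: 'n fn. f \<in> orlicz_space \<Phi> \<and> \<not> (AE x in lebesgue. f x = 0) \<longrightarrow>
              (\<forall>x. \<Psi> (frac_maximal \<rho> f x / (ennreal C\<^sub>1 * orlicz_norm \<Phi> f))
                 \<le> \<Phi> (HL_maximal f x / (ennreal C\<^sub>0 * orlicz_norm \<Phi> f)))) \<and>
           (\<Phi> \<in> nabla2_bar \<longrightarrow>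
             (\<forall>f :: 'n fn. f \<in> weak_orlicz_space \<Phi> \<and> \<not> (AE x in lebesgue. f x = 0) \<longrightarrow>
                (\<forall>x. \<Psi> (frac_maximal \<rho> f x / (ennreal C\<^sub>1 * weak_orlicz_norm \<Phi> f))
                   \<le> \<Phi> (HL_maximal f x / (ennreal C\<^sub>0 * weak_orlicz_norm \<Phi> f)))))"
      \<comment> \<open>\<open>C\<^sub>1\<close> is fixed before the nabla-2 condition is assumed,
        so it must accommodate the constants of both spaces.\<close>
      proof (intro exI[of _ "A * max C\<^sub>0 (max \<kappa>1 \<kappa>2)"] conjI impI allI)
        show "A * max C\<^sub>0 (max \<kappa>1 \<kappa>2) > 0" using A C0 by simp
      next
        fix f :: "'n fn" and x assume "f \<in> orlicz_space \<Phi> \<and> \<not> (AE x in lebesgue. f x = 0)"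
        then show "\<Psi> (frac_maximal \<rho> f x / (ennreal (A * max C\<^sub>0 (max \<kappa>1 \<kappa>2)) * orlicz_norm \<Phi> f))
          \<le> \<Phi> (HL_maximal f x / (ennreal C\<^sub>0 * orlicz_norm \<Phi> f))"
          by (intro frac_maximal_pointwise[OF \<Phi> \<Psi> cond A C0 avg1]) auto
      next
        fix f :: "'n fn" and x assume "\<Phi> \<in> nabla2_bar" "f \<in> weak_orlicz_space \<Phi> \<and> \<not> (AE x in lebesgue. f x = 0)"
        then show "\<Psi> (frac_maximal \<rho> f x / (ennreal (A * max C\<^sub>0 (max \<kappa>1 \<kappa>2)) * weak_orlicz_norm \<Phi> f))
          \<le> \<Phi> (HL_maximal f x / (ennreal C\<^sub>0 * weak_orlicz_norm \<Phi> f))"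
          by (intro frac_maximal_pointwise[OF \<Phi> \<Psi> cond A C0 avg2]) auto
      qed
    qed
    show "bounded_operator (frac_maximal_op \<rho> :: 'n fn \<Rightarrow> 'n fn) (orlicz_norm \<Phi>) (weak_orlicz_norm \<Psi>)"
    proof -
      obtain D where D: "D > 0" "\<forall>f :: 'n fn. \<forall>\<nu> > 0. f \<in> orlicz_space \<Phi> \<and> orlicz_norm \<Phi> f = ennreal \<nu> \<longrightarrow>
        weak_modular_le_1 \<Phi> (\<lambda>x. HL_maximal f x / ennreal (D * \<nu>))"
        using orlicz_weak_modular_HL[OF assms(1)] by blast
      show ?thesis
      proof (rule frac_maximal_bounded[OF \<Phi> \<Psi> cond A \<kappa>1 D(1) avg1])
        fix f :: "'n fn" and \<nu> L :: real
        assume f: "f \<in> orlicz_space \<Phi>" "\<nu> > 0" "orlicz_norm \<Phi> f = ennreal \<nu>" and L: "L > 0"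
          and le: "\<And>x. \<Psi> (frac_maximal \<rho> f x / ennreal L) \<le> \<Phi> (HL_maximal f x / ennreal (D * \<nu>))"
        have HL: "weak_modular_le_1 \<Phi> (\<lambda>x. HL_maximal f x / ennreal (D * \<nu>))"
          using D(2) f by blast
        show "weak_orlicz_norm \<Psi> (frac_maximal_op \<rho> f) \<le> ennreal L"
          by (rule weak_orlicz_norm_frac_maximal_le[OF L weak_modular_transfer[OF \<Phi> \<Psi> HL HL_measurable le]])
      qed (rule weak_orlicz_norm_0)
    qed
    assume nabla: "\<Phi> \<in> nabla2_bar"
    show "bounded_operator (frac_maximal_op \<rho> :: 'n fn \<Rightarrow> 'n fn) (orlicz_norm \<Phi>) (orlicz_norm \<Psi>)"
    proof -
      obtain D where D: "D > 0" "\<forall>f :: 'n fn. \<forall>\<nu> > 0. f \<in> orlicz_space \<Phi> \<and> orlicz_norm \<Phi> f = ennreal \<nu> \<longrightarrow>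
        (\<integral>\<^sup>+x. \<Phi> (HL_maximal f x / ennreal (D * \<nu>)) \<partial>lebesgue) \<le> 1"
        using orlicz_modular_HL[OF nabla] by blast
      show ?thesis
      proof (rule frac_maximal_bounded[OF \<Phi> \<Psi> cond A \<kappa>1 D(1) avg1])
        fix f :: "'n fn" and \<nu> L :: real
        assume f: "f \<in> orlicz_space \<Phi>" "\<nu> > 0" "orlicz_norm \<Phi> f = ennreal \<nu>" and L: "L > 0"
          and le: "\<And>x. \<Psi> (frac_maximal \<rho> f x / ennreal L) \<le> \<Phi> (HL_maximal f x / ennreal (D * \<nu>))"
        have HL: "(\<integral>\<^sup>+x. \<Phi> (HL_maximal f x / ennreal (D * \<nu>)) \<partial>lebesgue) \<le> 1"
          using D(2) f by blast
        show "orlicz_norm \<Psi> (frac_maximal_op \<rho> f) \<le> ennreal L"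
          by (rule orlicz_norm_frac_maximal_le[OF L order_trans[OF nn_integral_mono[OF le] HL]])
      qed (rule orlicz_norm_0[OF \<Psi>])
    qed
    show "bounded_operator (frac_maximal_op \<rho> :: 'n fn \<Rightarrow> 'n fn) (weak_orlicz_norm \<Phi>) (weak_orlicz_norm \<Psi>)"
    proof -
      obtain D where D: "D > 0" "\<forall>f :: 'n fn. \<forall>\<nu> > 0. f \<in> weak_orlicz_space \<Phi> \<and> weak_orlicz_norm \<Phi> f = ennreal \<nu> \<longrightarrow>
        weak_modular_le_1 \<Phi> (\<lambda>x. HL_maximal f x / ennreal (D * \<nu>))"
        using weak_orlicz_weak_modular_HL[OF nabla] by blast
      show ?thesis
      proof (rule frac_maximal_bounded[OF \<Phi> \<Psi> cond A \<kappa>2 D(1) avg2[OF nabla]])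
        fix f :: "'n fn" and \<nu> L :: real
        assume f: "f \<in> weak_orlicz_space \<Phi>" "\<nu> > 0" "weak_orlicz_norm \<Phi> f = ennreal \<nu>" and L: "L > 0"
          and le: "\<And>x. \<Psi> (frac_maximal \<rho> f x / ennreal L) \<le> \<Phi> (HL_maximal f x / ennreal (D * \<nu>))"
        have HL: "weak_modular_le_1 \<Phi> (\<lambda>x. HL_maximal f x / ennreal (D * \<nu>))"
          using D(2) f by blast
        show "weak_orlicz_norm \<Psi> (frac_maximal_op \<rho> f) \<le> ennreal L"
          by (rule weak_orlicz_norm_frac_maximal_le[OF L weak_modular_transfer[OF \<Phi> \<Psi> HL HL_measurable le]])
      qed (rule weak_orlicz_norm_0)
    qed
  next
    assume "bounded_operator (frac_maximal_op \<rho> :: 'n fn \<Rightarrow> 'n fn) (orlicz_norm \<Phi>) (weak_orlicz_norm \<Psi>)"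
    then show "\<exists>A > 0. sup_rho_condition CARD('n) \<rho> \<Phi> \<Psi> A"
      using weak_orlicz_norm_ge_on_ball[OF assms(2)] sup_rho_condition_necessary[OF assms(1,2)] by blast
  next
    let ?\<psi> = "\<lambda>r. gen_inv \<Psi> (ennreal (1 / r ^ CARD('n)))"
    assume "bounded_operator (frac_maximal_op \<rho> :: 'n fn \<Rightarrow> 'n fn) (orlicz_norm \<Phi>) (L1psi_norm ?\<psi>)"
    then show "\<exists>A > 0. sup_rho_condition CARD('n) \<rho> \<Phi> \<Psi> A"
    \<comment> \<open>Since \<psi> R is \<Psi>^-1 (1 / R^n) by definition, testing the norm on the
      single ball B(0, R) gives the lower bound with constant 1.\<close>
    proof (rule sup_rho_condition_necessary[OF assms(1,2) _ zero_less_one large_on_ballsI])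
      fix h :: "real ^ 'n \<Rightarrow> ennreal" and R :: real and S
      assume h: "h \<in> borel_measurable lebesgue" "R > 0" "\<And>x. x \<in> ball 0 R \<Longrightarrow> S \<le> h x"
      obtain s where "?\<psi> R = ennreal s" "s > 0" using gen_inv_real[OF \<Psi>, of "1 / R ^ CARD('n)"] h(2) by auto
      then show "S \<le> ennreal 1 * ?\<psi> R * L1psi_norm ?\<psi> (\<lambda>x. enn2ereal (h x))"
        using L1psi_norm_ge_on_ball[OF h(1,2) _ _ h(3), of ?\<psi>] by simp
    qed
  qed
qed

end
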